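(* Let $A\in Gl(d,\mathbb{R})$, $B\in\mathbb{R}^{d\times m}$, and let $U\subset\mathbb{R}^m$ be a convex compact neighborhood of $0$ with $U=\overline{\mathrm{int}\,U}$. Consider the system $x_{k+1}=Ax_k+Bu_k$, $u_k\in U$, $k\in\mathbb{N}_0$, and assume that $(A,B)$ is controllable and $A$ is hyperbolic (no eigenvalue of absolute value $1$). Let $D$ be the unique control set with nonvoid interior and let $f\in C(\overline{D}\times U,\mathbb{R})$. Then there exists a compact set $K\subset D$ with nonvoid interior such that the total invariance pressure satisfies $$P_{tot}(f,K,D)\le\log|\det A^+|+\inf_{(\tau,x,u)}\frac1\tau\sum_{i=0}^{\tau-1}f(\varphi(i,x,u),u_i),$$ where the infimum is taken over all $\tau\in\mathbb{N}$ with $\tau\ge d$ and all $\tau$-periodic controls $u$ with a $\tau$-periodic trajectory $\varphi(\cdot,x,u)$ in $\mathrm{int}\,D$ such that $u_i\in\mathrm{int}\,U$ for $i\in\{0,\dots,\tau-1\}$.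
   Context: $\mathbb{N}=\{1,2,\dots\}$, $\mathbb{N}_0=\{0,1,2,\dots\}$, $\mathcal{U}=U^{\mathbb{N}_0}$. For $x\in\mathbb{R}^d$, $u=(u_i)\in\mathcal{U}$ the solution is $\varphi(k,x,u)=A^kx+\sum_{i=0}^{k-1}A^{k-1-i}Bu_i$. The reachable set is $\mathbf{R}(x)=\{\varphi(k,x,u)\mid k\in\mathbb{N},u\in\mathcal{U}\}$. $(A,B)$ is controllable if $\mathrm{rank}[B\ AB\ \cdots\ A^{d-1}B]=d$. A nonvoid set $D\subset\mathbb{R}^d$ is a control set if it is maximal (with respect to inclusion) with the properties: (i) $D\subset\overline{\mathbf{R}(x)}$ for all $x\in D$; (ii) for every $x\in D$ there is $u\in\mathcal{U}$ with $\varphi(k,x,u)\in D$ for all $k\in\mathbb{N}$. When $(A,B)$ is controllable there is exactly one control set with nonvoid interior. $A^+$ is the restriction of $A$ to the unstable subspace $E^u$, the direct sum of the generalized real eigenspaces of $A$ for eigenvalues with $|\lambda|>1$; thus $\log|\det A^+|=\sum_{\lambda\in\sigma(A)}n_\lambda\max\{0,\log|\lambda|\}$, where $n_\lambda$ is the algebraic multiplicity of $\lambda$. Total invariance pressure: for compact $K\subset D$ and $\tau\in\mathbb{N}$, a set $\mathcal{S}\subset\mathcal{U}$ is $(\tau,K,D)$-spanning if for all $x\in K$ there is $u\in\mathcal{S}$ with $\varphi(k,x,u)\in D$ for all $k\in\{1,\dots,\tau\}$. A totally $(\tau,K,D)$-spanning set is a set of pairs $\mathcal{S}_{tot}=\{(x_u,u)\mid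 u\in\mathcal{S}\}$, where $\mathcal{S}$ is $(\tau,K,D)$-spanning and to every $u\in\mathcal{S}$ there is associated one point $x_u\in K$ with $\varphi(k,x_u,u)\in D$ for all $k\in\{1,\dots,\tau\}$. Put $(S_\tau f)(x,u)=\sum_{i=0}^{\tau-1}f(\varphi(i,x,u),u_i)$, $a_\tau(f,K,D)=\inf\{\sum_{(x,u)\in\mathcal{S}_{tot}}e^{(S_\tau f)(x,u)}\mid\mathcal{S}_{tot}\text{ totally }(\tau,K,D)\text{-spanning}\}$, and $P_{tot}(f,K,D)=\limsup_{\tau\to\infty}\frac1\tau\log a_\tau(f,K,D)$. $\tau$-periodic means $u_{i+\tau}=u_i$ and $\varphi(i+\tau,x,u)=\varphi(i,x,u)$ for all $i\in\mathbb{N}_0$. *)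

theory Defs
  imports "HOL-Analysis.Analysis"
begin

section \<open>Linear algebra\<close>

text \<open>The overloaded power on \<open>'a ^ 'n ^ 'n\<close> is componentwise, hence a separate matrix power.\<close>

primrec matpow :: "'a::semiring_1 ^ 'n ^ 'n \<Rightarrow> nat \<Rightarrow> 'a ^ 'n ^ 'n" where
  "matpow M 0 = mat 1"
| "matpow M (Suc k) = M ** matpow M k"

text \<open>
  The block matrix \<open>[B  AB  \<dots>  A^(d-1) B]\<close> with \<open>d = CARD('d)\<close>. A column index is a pair
  of a block index of type \<open>'d\<close>, enumerated by \<open>to_nat_on UNIV\<close> as a bijection onto
  \<open>{..<d}\<close>, and a column index of \<open>B\<close>; the choice of the enumeration only permutes the blocks.
\<close>

definition kalman_matrix :: "real ^ 'd ^ 'd \<Rightarrow> real ^ 'm ^ 'd \<Rightarrow> real ^ ('d \<times> 'm) ^ 'd" where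
  "kalman_matrix A B =
     (\<chi> i kj. (matpow A (to_nat_on (UNIV :: 'd set) (fst kj)) ** B) $ i $ snd kj)"

definition controllable :: "real ^ 'd ^ 'd \<Rightarrow> real ^ 'm ^ 'd \<Rightarrow> bool" where
  "controllable A B \<longleftrightarrow> rank (kalman_matrix A B) = CARD('d)"

abbreviation cmat :: "real ^ 'd ^ 'd \<Rightarrow> complex ^ 'd ^ 'd" where
  "cmat A \<equiv> map_matrix complex_of_real A"

definition spectrum :: "real ^ 'd ^ 'd \<Rightarrow> complex set" where
  "spectrum A = {\<mu>. \<exists>v. v \<noteq> 0 \<and> cmat A *v v = \<mu> *s v}"

definition hyperbolic :: "real ^ 'd ^ 'd \<Rightarrow> bool" where
  "hyperbolic A \<longleftrightarrow> (\<forall>\<mu>\<in>spectrum A. cmod \<mu> \<noteq> 1)"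

definition gen_eigenspace :: "complex ^ 'd ^ 'd \<Rightarrow> complex \<Rightarrow> (complex ^ 'd) set" where
  "gen_eigenspace M \<mu> = {v. \<exists>k. matpow (M - mat \<mu>) k *v v = 0}"

text \<open>
  The generalized real eigenspace of a real or complex eigenvalue consists of the real parts of
  the complex generalized eigenvectors. As these are closed under multiplication by \<open>\<i>\<close>, it also
  contains all imaginary parts; it is the same for \<open>\<mu>\<close> and its conjugate.
\<close>

definition real_gen_eigenspace :: "real ^ 'd ^ 'd \<Rightarrow> complex \<Rightarrow> (real ^ 'd) set" where
  "real_gen_eigenspace A \<mu> = (\<lambda>v. \<chi> i. Re (v $ i)) ` gen_eigenspace (cmat A) \<mu>"

definition unstable_subspace :: "real ^ 'd ^ 'd \<Rightarrow> (real ^ 'd) set" where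
  "unstable_subspace A = span (\<Union>\<mu>\<in>{\<mu>\<in>spectrum A. cmod \<mu> > 1}. real_gen_eigenspace A \<mu>)"

text \<open>
  Determinant of the restriction of a linear map \<open>f\<close> to an invariant subspace \<open>E\<close>: the Leibniz
  formula for the matrix of the restriction with respect to some basis of \<open>E\<close>, with rows and
  columns indexed by the basis vectors themselves. It equals 1 for \<open>E = {0}\<close>.
\<close>

definition det_on :: "'a::euclidean_space set \<Rightarrow> ('a \<Rightarrow> 'a) \<Rightarrow> real" where
  "det_on E f =
     (let bs = (SOME bs. independent bs \<and> span bs = E) in
      \<Sum>p | p permutes bs. of_int (sign p) * (\<Prod>b\<in>bs. representation bs (f b) (p b)))"

definition det_unstable :: "real ^ 'd ^ 'd \<Rightarrow> real" where
  "det_unstable A = det_on (unstable_subspace A) (\<lambda>x. A *v x)"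


section \<open>The control system\<close>

definition controls :: "(real ^ 'm) set \<Rightarrow> (nat \<Rightarrow> real ^ 'm) set" where
  "controls U = {u. \<forall>i. u i \<in> U}"

definition sol ::
    "real ^ 'd ^ 'd \<Rightarrow> real ^ 'm ^ 'd \<Rightarrow> nat \<Rightarrow> real ^ 'd \<Rightarrow> (nat \<Rightarrow> real ^ 'm) \<Rightarrow> real ^ 'd" where
  "sol A B k x u = matpow A k *v x + (\<Sum>i<k. matpow A (k - 1 - i) *v (B *v u i))"

definition reachable ::
    "real ^ 'd ^ 'd \<Rightarrow> real ^ 'm ^ 'd \<Rightarrow> (real ^ 'm) set \<Rightarrow> real ^ 'd \<Rightarrow> (real ^ 'd) set" where
  "reachable A B U x = {sol A B k x u | k u. k \<ge> 1 \<and> u \<in> controls U}"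

definition control_set_props ::
    "real ^ 'd ^ 'd \<Rightarrow> real ^ 'm ^ 'd \<Rightarrow> (real ^ 'm) set \<Rightarrow> (real ^ 'd) set \<Rightarrow> bool" where
  "control_set_props A B U D \<longleftrightarrow>
     (\<forall>x\<in>D. D \<subseteq> closure (reachable A B U x)) \<and>
     (\<forall>x\<in>D. \<exists>u\<in>controls U. \<forall>k\<ge>1. sol A B k x u \<in> D)"

definition control_set ::
    "real ^ 'd ^ 'd \<Rightarrow> real ^ 'm ^ 'd \<Rightarrow> (real ^ 'm) set \<Rightarrow> (real ^ 'd) set \<Rightarrow> bool" where
  "control_set A B U D \<longleftrightarrow>
     D \<noteq> {} \<and> control_set_props A B U D \<and>
     (\<forall>D'. D \<subseteq> D' \<and> control_set_props A B U D' \<longrightarrow> D' = D)"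


section \<open>Total invariance pressure\<close>

definition spanning ::
    "real ^ 'd ^ 'd \<Rightarrow> real ^ 'm ^ 'd \<Rightarrow> (real ^ 'm) set \<Rightarrow> nat \<Rightarrow> (real ^ 'd) set \<Rightarrow> (real ^ 'd) set
      \<Rightarrow> (nat \<Rightarrow> real ^ 'm) set \<Rightarrow> bool" where
  "spanning A B U \<tau> K D S \<longleftrightarrow>
     S \<subseteq> controls U \<and> (\<forall>x\<in>K. \<exists>u\<in>S. \<forall>k\<in>{1..\<tau>}. sol A B k x u \<in> D)"

definition totally_spanning ::
    "real ^ 'd ^ 'd \<Rightarrow> real ^ 'm ^ 'd \<Rightarrow> (real ^ 'm) set \<Rightarrow> nat \<Rightarrow> (real ^ 'd) set \<Rightarrow> (real ^ 'd) set
      \<Rightarrow> ((real ^ 'd) \<times> (nat \<Rightarrow> real ^ 'm)) set \<Rightarrow> bool" where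
  "totally_spanning A B U \<tau> K D S_tot \<longleftrightarrow>
     (\<exists>S \<xi>. spanning A B U \<tau> K D S \<and>
        (\<forall>u\<in>S. \<xi> u \<in> K \<and> (\<forall>k\<in>{1..\<tau>}. sol A B k (\<xi> u) u \<in> D)) \<and>
        S_tot = {(\<xi> u, u) | u. u \<in> S})"

definition birkhoff_sum ::
    "real ^ 'd ^ 'd \<Rightarrow> real ^ 'm ^ 'd \<Rightarrow> ((real ^ 'd) \<times> (real ^ 'm) \<Rightarrow> real) \<Rightarrow> nat \<Rightarrow> real ^ 'd
      \<Rightarrow> (nat \<Rightarrow> real ^ 'm) \<Rightarrow> real" where
  "birkhoff_sum A B f \<tau> x u = (\<Sum>i<\<tau>. f (sol A B i x u, u i))"

text \<open>
  Totally spanning sets may be infinite and need not exist. The sums therefore take values in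
  \<open>[0, \<infinity>]\<close>, where every family is summable, and the infimum of the empty set is \<open>\<infinity>\<close>.
\<close>

definition a_tot ::
    "real ^ 'd ^ 'd \<Rightarrow> real ^ 'm ^ 'd \<Rightarrow> (real ^ 'm) set \<Rightarrow> ((real ^ 'd) \<times> (real ^ 'm) \<Rightarrow> real)
      \<Rightarrow> (real ^ 'd) set \<Rightarrow> (real ^ 'd) set \<Rightarrow> nat \<Rightarrow> ennreal" where
  "a_tot A B U f K D \<tau> =
     (INF S_tot\<in>{S_tot. totally_spanning A B U \<tau> K D S_tot}.
        infsum (\<lambda>(x, u). ennreal (exp (birkhoff_sum A B f \<tau> x u))) S_tot)"

definition ln_ennreal :: "ennreal \<Rightarrow> ereal" where
  "ln_ennreal a = (if a = 0 then -\<infinity> else if a = \<infinity> then \<infinity> else ereal (ln (enn2real a)))"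

definition P_tot ::
    "real ^ 'd ^ 'd \<Rightarrow> real ^ 'm ^ 'd \<Rightarrow> (real ^ 'm) set \<Rightarrow> ((real ^ 'd) \<times> (real ^ 'm) \<Rightarrow> real)
      \<Rightarrow> (real ^ 'd) set \<Rightarrow> (real ^ 'd) set \<Rightarrow> ereal" where
  "P_tot A B U f K D =
     limsup (\<lambda>\<tau>. ereal (1 / real \<tau>) * ln_ennreal (a_tot A B U f K D \<tau>))"

definition periodic_data ::
    "real ^ 'd ^ 'd \<Rightarrow> real ^ 'm ^ 'd \<Rightarrow> (real ^ 'm) set \<Rightarrow> (real ^ 'd) set
      \<Rightarrow> (nat \<times> (real ^ 'd) \<times> (nat \<Rightarrow> real ^ 'm)) set" where
  "periodic_data A B U D =
     {(\<tau>, x, u). \<tau> \<ge> CARD('d) \<and> u \<in> controls U \<and>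
        (\<forall>i. u (i + \<tau>) = u i) \<and> (\<forall>i. sol A B (i + \<tau>) x u = sol A B i x u) \<and>
        (\<forall>i. sol A B i x u \<in> interior D) \<and> (\<forall>i<\<tau>. u i \<in> interior U)}"

end

theory Submission
  imports Defs "HOL-Computational_Algebra.Fundamental_Theorem_Algebra"
begin

text \<open>
  Any closed ball \<open>K\<close> inside the control set serves all periodic orbits at once. By compactness,
  finitely many controls steer \<open>K\<close> to a small ball around a given periodic point \<open>x\<close>, and maximality of
  \<open>D\<close> keeps these transients in \<open>D\<close>. Relative to the periodic orbit the system is the linear system
  near \<open>0\<close> with small controls. There every small initial value \<open>z\<close> is driven to \<open>0\<close> by a small
  control that depends linearly on \<open>z\<close>, and the control chosen for \<open>z\<close> also works up to time \<open>n\<close> for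
  all points of the Bowen ball around \<open>z\<close> of the uncontrolled system. By a volume argument about
  \<open>\<bar>det A^+\<bar>^n\<close> Bowen balls suffice. All resulting trajectories shadow the periodic one, so each
  Birkhoff sum is at most \<open>n\<close> times the periodic average, up to \<open>n\<close> times an arbitrarily small
  \<open>\<gamma> > 0\<close> and a constant.
\<close>

section \<open>Solutions and control sets\<close>

text \<open>The number of controls must grow like \<open>\<bar>det_unstable A\<bar> ^ n\<close> up
  to a factor free of \<open>n\<close>, whereas volumes under \<open>A\<close> itself also record
  the contraction in the stable directions. An auxiliary matrix therefore replaces \<open>A\<close>
  by the identity on the stable subspace: its powers scale volume by exactly the unstable
  determinant and still dominate all iterates of \<open>A\<close> up to time \<open>n\<close>. The
  stable subspace is described dynamically, by forward iterates tending to zero. Complex generalized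
  eigenvectors show that it spans together with the unstable subspace, and that the inverse
  contracts the latter. A null control for one initial value is applied open loop to its neighbours;
  by superposition the two trajectories then differ by the free motion of \<open>A\<close>, which is
  what a Bowen ball measures. Number and length of the transients and the packing constant depend on
  the orbit and on the tolerance, but not on \<open>n\<close>, and so drop out of the exponential
  growth rate.\<close>

lemma sol_0 [simp]: "sol A B 0 x u = x"
  by (simp add: sol_def)

lemma sol_Suc [simp]: "sol A B (Suc k) x u = A *v sol A B k x u + B *v u k"
proof -
  have "A *v (\<Sum>i<k. matpow A (k - 1 - i) *v (B *v u i)) = (\<Sum>i<k. matpow A (k - i) *v (B *v u i))"
    unfolding linear_sum[OF matrix_vector_mul_linear]
  proof (rule sum.cong)
    fix i assume "i \<in> {..<k}"
    then have "k - i = Suc (k - 1 - i)" by auto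
    then show "A *v (matpow A (k - 1 - i) *v (B *v u i)) = matpow A (k - i) *v (B *v u i)"
      by (simp add: matrix_vector_mul_assoc matrix_mul_assoc)
  qed simp
  then show ?thesis
    by (simp add: sol_def matrix_vector_right_distrib matrix_vector_mul_assoc)
qed

lemma sol_add: "sol A B (k + l) x u = sol A B l (sol A B k x u) (\<lambda>i. u (k + i))"
  by (induction l) auto

lemma sol_cong: "(\<And>i. i < k \<Longrightarrow> u i = v i) \<Longrightarrow> sol A B k x u = sol A B k x v"
  by (induction k) auto

lemma sol_plus: "sol A B k (x + y) (\<lambda>i. u i + v i) = sol A B k x u + sol A B k y v"
  by (induction k) (auto simp: matrix_vector_right_distrib)

lemma sol_scaleR: "sol A B k (c *\<^sub>R x) (\<lambda>i. c *\<^sub>R u i) = c *\<^sub>R sol A B k x u"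
  by (induction k) (auto simp: scaleR_right_distrib matrix_vector_mult_scaleR)

lemma sol_zero_control: "sol A B k x (\<lambda>_. 0) = matpow A k *v x"
  by (simp add: sol_def)

lemma continuous_on_sol [continuous_intros]:
  "continuous_on S g \<Longrightarrow> continuous_on S (\<lambda>x. sol A B k (g x) u)"
  unfolding sol_def
  by (intro continuous_intros bounded_linear.continuous_on[OF matrix_vector_mul_bounded_linear])

section \<open>Concatenation of controls and reachability\<close>

definition concat_control :: "nat \<Rightarrow> (nat \<Rightarrow> 'a) \<Rightarrow> (nat \<Rightarrow> 'a) \<Rightarrow> nat \<Rightarrow> 'a" where
  "concat_control T u v i = (if i < T then u i else v (i - T))"

lemma concat_control_in_controls:
  "u \<in> controls U \<Longrightarrow> v \<in> controls U \<Longrightarrow> concat_control T u v \<in> controls U"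
  by (auto simp: controls_def concat_control_def)

lemma sol_concat_control_le: "k \<le> T \<Longrightarrow> sol A B k x (concat_control T u v) = sol A B k x u"
  by (rule sol_cong) (auto simp: concat_control_def)

lemma sol_concat_control_add:
  "sol A B (T + k) x (concat_control T u v) = sol A B k (sol A B T x u) v"
  by (simp add: sol_add sol_concat_control_le) (simp add: concat_control_def)

lemma shift_in_controls: "u \<in> controls U \<Longrightarrow> (\<lambda>i. u (k + i)) \<in> controls U"
  by (auto simp: controls_def)

lemma reachable_sol:
  assumes "y \<in> reachable A B U x" and "u \<in> controls U"
  shows "sol A B k y u \<in> reachable A B U x"
proof -
  obtain T v where T: "T \<ge> 1" "v \<in> controls U" "y = sol A B T x v"
    using assms(1) by (auto simp: reachable_def)
  then have "sol A B k y u = sol A B (T + k) x (concat_control T v u)"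
    by (simp add: sol_concat_control_add)
  moreover have "T + k \<ge> 1" using T(1) by simp
  moreover have "concat_control T v u \<in> controls U"
    by (rule concat_control_in_controls) fact+
  ultimately show ?thesis
    unfolding reachable_def by blast
qed

lemma reachable_trans:
  "y \<in> reachable A B U x \<Longrightarrow> reachable A B U y \<subseteq> reachable A B U x"
  using reachable_sol by (fastforce simp: reachable_def)

text \<open>Solutions depend continuously on the initial value, so forward invariance passes to the
  closure. The closure is what matters, since a control set offers only approximate
  reachability.\<close>

lemma closure_reachable_sol:
  assumes "y \<in> closure (reachable A B U x)" and "u \<in> controls U"
  shows "sol A B k y u \<in> closure (reachable A B U x)"
proof -
  have "(\<lambda>z. sol A B k z u) ` closure (reachable A B U x) \<subseteq> closure (reachable A B U x)"
  proof (rule image_closure_subset)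
    show "continuous_on (closure (reachable A B U x)) (\<lambda>z. sol A B k z u)"
      by (intro continuous_intros)
    show "(\<lambda>z. sol A B k z u) ` reachable A B U x \<subseteq> closure (reachable A B U x)"
      using reachable_sol[OF _ assms(2)] closure_subset by fast
  qed simp
  with assms(1) show ?thesis by blast
qed

text \<open>Adjoin the excursion to \<open>D\<close>. Its points are approximately reachable from
  \<open>D\<close>, and each of them leads back to \<open>?s n\<close> in \<open>D\<close>; hence
  the larger set \<open>D'\<close> has both defining properties of a control set, and maximality
  gives \<open>D' = D\<close>.\<close>

lemma control_set_no_return:
  assumes D: "control_set A B U D" and x: "x \<in> D" and u: "u \<in> controls U"
    and n: "sol A B n x u \<in> D" and "k \<le> n"
  shows "sol A B k x u \<in> D"
proof -
  let ?s = "\<lambda>k. sol A B k x u"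
  define D' where "D' = D \<union> ?s ` {..n}"
  have approx: "\<And>y. y \<in> D \<Longrightarrow> D \<subseteq> closure (reachable A B U y)"
    and stay: "\<And>y. y \<in> D \<Longrightarrow> \<exists>v\<in>controls U. \<forall>k\<ge>1. sol A B k y v \<in> D"
    using D by (auto simp: control_set_def control_set_props_def)
  have approx': "D' \<subseteq> closure (reachable A B U y)" if "y \<in> D" for y
  proof -
    have "x \<in> closure (reachable A B U y)"
      using approx[OF that] x by blast
    then have "?s j \<in> closure (reachable A B U y)" for j
      using u by (rule closure_reachable_sol)
    then show ?thesis
      using approx[OF that] by (auto simp: D'_def)
  qed
  have tail: "?s n = sol A B (n - j) (?s j) (\<lambda>i. u (j + i))" if "j \<le> n" for j
    using that sol_add[of A B j "n - j" x u] by simp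
  have "D' \<subseteq> closure (reachable A B U (?s j))" if "j \<le> n" for j
  \<comment> \<open>\<open>reachable\<close> demands at least one time step, so the end point cannot
    be said to reach itself; there \<open>?s n \<in> D\<close> is used directly.\<close>
  proof (cases "j = n")
    case False
    then have "n - j \<ge> 1" using that by simp
    with tail[OF that] shift_in_controls[OF u] have "?s n \<in> reachable A B U (?s j)"
      unfolding reachable_def by blast
    from closure_mono[OF reachable_trans[OF this]] approx'[OF n] show ?thesis by blast
  qed (use n approx' in auto)
  moreover have "\<exists>v\<in>controls U. \<forall>k\<ge>1. sol A B k (?s j) v \<in> D'" if j: "j \<le> n" for j
  proof -
    obtain v where v: "v \<in> controls U" "\<And>k. k \<ge> 1 \<Longrightarrow> sol A B k (?s n) v \<in> D"
      using stay[OF n] by auto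
    \<comment> \<open>Complete the excursion up to \<open>?s n\<close>, then switch to the control
      that keeps \<open>?s n\<close> in \<open>D\<close>.\<close>
    let ?w = "concat_control (n - j) (\<lambda>i. u (j + i)) v"
    have "sol A B k (?s j) ?w \<in> D'" for k
    proof (cases "k \<le> n - j")
      case True
      then have "sol A B k (?s j) ?w = ?s (j + k)"
        by (simp add: sol_concat_control_le sol_add)
      then show ?thesis using True j by (auto simp: D'_def)
    next
      case False
      then obtain l where l: "k = (n - j) + l" "l \<ge> 1"
        by (intro that[of "k - (n - j)"]) auto
      then have "sol A B k (?s j) ?w = sol A B l (?s n) v"
        by (simp only: sol_concat_control_add tail[OF j])
      then show ?thesis using v l by (auto simp: D'_def)
    qed
    moreover have "?w \<in> controls U"
      using u v by (auto intro: concat_control_in_controls shift_in_controls)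
    ultimately show ?thesis by blast
  qed
  ultimately have props: "D' \<subseteq> closure (reachable A B U (?s j))"
    "\<exists>v\<in>controls U. \<forall>k\<ge>1. sol A B k (?s j) v \<in> D'" if "j \<le> n" for j
    using that by blast+
  have "control_set_props A B U D'"
    unfolding control_set_props_def
  proof (intro conjI ballI)
    fix y assume "y \<in> D'"
    then consider "y \<in> D" | j where "j \<le> n" "y = ?s j"
      by (auto simp: D'_def)
    then show "D' \<subseteq> closure (reachable A B U y)"
      using approx' props(1) by cases auto
  next
    fix y assume "y \<in> D'"
    then consider "y \<in> D" | j where "j \<le> n" "y = ?s j"
      by (auto simp: D'_def)
    then show "\<exists>v\<in>controls U. \<forall>k\<ge>1. sol A B k y v \<in> D'"
    proof cases
      case 1
      from stay[OF this] show ?thesis unfolding D'_def by blast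
    next
      case 2
      with props(2) show ?thesis by simp
    qed
  qed
  then have "D' = D"
    using D unfolding control_set_def D'_def by blast
  with \<open>k \<le> n\<close> show ?thesis by (auto simp: D'_def)
qed

text \<open>Approximate reachability suffices because the target is an open ball: a pair
  \<open>(T, v)\<close> that steers \<open>y\<close> into it also steers a neighbourhood of
  \<open>y\<close>.\<close>

lemma finite_steering:
  assumes D: "control_set A B U D" and "compact K" and "K \<subseteq> D" and "x \<in> D" and "r > 0"
  shows "\<exists>J. finite J \<and> (\<forall>(T, v)\<in>J. v \<in> controls U) \<and>
    (\<forall>y\<in>K. \<exists>(T, v)\<in>J. sol A B T y v \<in> ball x r)"
proof -
  let ?P = "{(T::nat, v). v \<in> controls U}"
  let ?N = "\<lambda>(T, v). {y. sol A B T y v \<in> ball x r}"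
  have "\<exists>p\<in>?P. y \<in> ?N p" if "y \<in> K" for y
  proof -
    have "x \<in> closure (reachable A B U y)"
      using D that assms by (auto simp: control_set_def control_set_props_def)
    then obtain z where "z \<in> reachable A B U y" "z \<in> ball x r"
      using \<open>r > 0\<close> by (metis closure_approachable dist_commute mem_ball)
    then show ?thesis by (auto simp: reachable_def)
  qed
  then have cover: "K \<subseteq> (\<Union>p\<in>?P. ?N p)" by blast
  have opn: "open (?N p)" for p
  proof -
    have "open ((\<lambda>y. sol A B (fst p) y (snd p)) -` ball x r)"
      by (intro open_vimage open_ball continuous_intros)
    then show ?thesis by (simp add: vimage_def split_beta)
  qed
  obtain J where "J \<subseteq> ?P" "finite J" "K \<subseteq> (\<Union>p\<in>J. ?N p)"
    using compactE_image[OF \<open>compact K\<close> opn cover] by metis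
  then show ?thesis by (intro exI[of _ J]) fastforce
qed

section \<open>Determinants and packing\<close>

text \<open>Conjugation by \<open>g\<close> identifies the two permutation groups and preserves
  signs. This serves to change the index type of a determinant and to compare \<open>det\<close>
  with the basis-indexed sum in \<open>det_on\<close>.\<close>

lemma leibniz_sum_reindex:
  fixes M :: "'b \<Rightarrow> 'b \<Rightarrow> 'c::comm_ring_1"
  assumes "bij_betw g S T" and "finite S"
  shows "(\<Sum>p | p permutes T. of_int (sign p) * (\<Prod>b\<in>T. M b (p b))) =
    (\<Sum>q | q permutes S. of_int (sign q) * (\<Prod>a\<in>S. M (g a) (g (q a))))"
proof -
  have g: "inj_on g S" "g ` S = T"
    using assms(1) by (auto simp: bij_betw_def)
  have bij: "bij_betw (map_permutation S g) {q. q permutes S} {p. p permutes T}"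
  proof -
    have "map_permutation S g = (\<lambda>q x. if x \<in> T then g (q (inv_into S g x)) else x)"
      by (auto simp: map_permutation_def restrict_id_def g(2) fun_eq_iff)
    then show ?thesis
      using bij_betw_permutations[OF assms(1)] by simp
  qed
  show ?thesis
    unfolding sum.reindex_bij_betw[OF bij, symmetric]
    by (intro sum.cong) (simp_all add: sign_map_permutation g assms(2)
        prod.reindex[OF g(1), unfolded g(2)] map_permutation_apply)
qed

lemma det_reindex:
  fixes M :: "'a::comm_ring_1 ^ 'n ^ 'n" and g :: "'k::finite \<Rightarrow> 'n"
  assumes "bij g"
  shows "det (\<chi> i j. M $ g i $ g j) = det M"
  using leibniz_sum_reindex[OF assms, of "\<lambda>i j. M $ i $ j"] by (simp add: det_def)

text \<open>Change of basis: the matrix \<open>Q\<close> with the basis vectors as columns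
  conjugates \<open>L\<close> to its coordinate matrix, and \<open>det Q\<close> cancels.\<close>

lemma det_eq_leibniz_sum_representation:
  fixes L :: "real ^ 'd ^ 'd"
  assumes W: "independent W" "span W = UNIV"
  shows "det L = (\<Sum>p | p permutes W. of_int (sign p) *
    (\<Prod>b\<in>W. representation W (L *v b) (p b)))"
proof -
  have fin: "finite W" using W(1) by (rule independent_imp_finite)
  have "card W = dim (span W)"
    by (simp add: dim_eq_card_independent W(1))
  then have "card W = CARD('d)"
    by (simp add: W(2) dim_UNIV)
  then obtain g where g: "bij_betw g (UNIV :: 'd set) W"
    using fin finite_same_card_bij[of "UNIV :: 'd set" W] by auto
  then have gW: "g i \<in> W" for i by (auto simp: bij_betw_def)
  define Q where "Q = (\<chi> i j. g j $ i)"
  \<comment> \<open>Row \<open>i\<close> holds the coordinates of the image of \<open>g i\<close>,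
    which is the transpose of the usual coordinate matrix; the determinant is the same.\<close>
  define N where "N = (\<chi> i j. representation W (L *v g i) (g j))"
  have Q: "Q *v x = (\<Sum>j\<in>UNIV. x $ j *\<^sub>R g j)" for x
    by (simp add: Q_def vec_eq_iff matrix_vector_mult_def mult.commute)
  have rep: "(\<Sum>j\<in>UNIV. representation W v (g j) *\<^sub>R g j) = v" for v
    unfolding sum.reindex_bij_betw[OF g, of "\<lambda>b. representation W v b *\<^sub>R b"]
    by (rule sum_representation_eq) (use W fin in auto)
  have "surj ((*v) Q)"
  proof (rule surjI)
    show "Q *v (\<chi> j. representation W v (g j)) = v" for v
      by (simp add: Q rep)
  qed
  then have "det Q \<noteq> 0"
    by (simp flip: matrix_right_invertible_surjective invertible_right_inverse invertible_det_nz)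
  have "L ** Q = Q ** transpose N"
  proof -
    have "column i (L ** Q) = column i (Q ** transpose N)" for i
    proof -
      have "column i (L ** Q) = L *v g i"
        by (simp add: vec_eq_iff column_def matrix_matrix_mult_def matrix_vector_mult_def Q_def)
      moreover have "column i (Q ** transpose N) = Q *v (\<chi> j. representation W (L *v g i) (g j))"
        by (simp add: vec_eq_iff column_def matrix_matrix_mult_def matrix_vector_mult_def
            transpose_def N_def)
      ultimately show ?thesis by (simp add: Q rep)
    qed
    then show ?thesis by (simp add: vec_eq_iff column_def)
  qed
  from arg_cong[OF this, of det] have "det L * det Q = det N * det Q"
    by (simp add: det_mul)
  with \<open>det Q \<noteq> 0\<close> have "det L = det N"
    by simp
  also have "\<dots> = (\<Sum>p | p permutes W. of_int (sign p) *
      (\<Prod>b\<in>W. representation W (L *v b) (p b)))"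
    using leibniz_sum_reindex[OF g, of "\<lambda>b c. representation W (L *v b) c"]
    by (simp add: det_def N_def)
  finally show ?thesis .
qed

text \<open>The dimensions of the two spans add up to that of the space, so the union is a spanning
  set of minimal size and hence independent.\<close>

lemma independent_Un_complementary:
  fixes bs cs :: "'a::euclidean_space set"
  assumes "independent bs" "independent cs" and cap: "span bs \<inter> span cs = {0}"
    and sum: "\<And>x. \<exists>y\<in>span bs. \<exists>z\<in>span cs. x = y + z"
  shows "independent (bs \<union> cs)" and "span (bs \<union> cs) = UNIV" and "bs \<inter> cs = {}"
proof -
  have "bs \<inter> cs \<subseteq> {0}"
    using cap by (blast intro: span_base)
  moreover have "0 \<notin> bs" using assms(1) dependent_zero by blast
  ultimately show disj: "bs \<inter> cs = {}" by blast
  show span: "span (bs \<union> cs) = UNIV"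
  proof -
    have "x \<in> span (bs \<union> cs)" for x
      using sum[of x] by (metis span_add span_mono subsetD sup_ge1 sup_ge2)
    then show ?thesis by blast
  qed
  have "{x + y |x y. x \<in> span bs \<and> y \<in> span cs} = UNIV"
  proof -
    have "x \<in> {x + y |x y. x \<in> span bs \<and> y \<in> span cs}" for x
      using sum[of x] by blast
    then show ?thesis by blast
  qed
  then have "dim (span bs) + dim (span cs) = DIM('a)"
    using dim_sums_Int[of "span bs" "span cs"] cap by (simp add: dim_UNIV)
  then have "card (bs \<union> cs) = DIM('a)"
    using assms(1,2) disj by (simp add: card_Un_disjoint independent_imp_finite dim_eq_card_independent)
  then show "independent (bs \<union> cs)"
    using span by (intro card_le_dim_spanning[of _ UNIV])
      (auto simp: dim_UNIV independent_imp_finite assms(1,2))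
qed

text \<open>In a basis adapted to the decomposition, only permutations that fix the basis vectors of
  \<open>F\<close> contribute to the Leibniz formula.\<close>

lemma det_on_eq_det:
  fixes L :: "real ^ 'd ^ 'd"
  assumes E: "subspace E" and F: "subspace F" and cap: "E \<inter> F = {0}"
    and sum: "\<And>x. \<exists>y\<in>E. \<exists>z\<in>F. x = y + z"
    and LE: "\<And>x. x \<in> E \<Longrightarrow> L *v x = f x" and inv: "\<And>x. x \<in> E \<Longrightarrow> f x \<in> E"
    and LF: "\<And>x. x \<in> F \<Longrightarrow> L *v x = x"
  shows "det_on E f = det L"
proof -
  \<comment> \<open>The same choice as in \<open>det_on\<close>, so that unfolding the definition at
    the end meets this very basis.\<close>
  define bs where "bs = (SOME bs. independent bs \<and> span bs = E)"
  have "\<exists>bs. independent bs \<and> span bs = E"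
    using orthonormal_basis_subspace[OF E] by metis
  from someI_ex[OF this] have bs: "independent bs" "span bs = E"
    unfolding bs_def by simp_all
  obtain cs where cs: "independent cs" "span cs = F"
    using orthonormal_basis_subspace[OF F] by metis
  define W where "W = bs \<union> cs"
  have W: "independent W" "span W = UNIV" and disj: "bs \<inter> cs = {}"
    using independent_Un_complementary[of bs cs] bs cs cap sum by (auto simp: W_def)
  have fin: "finite bs" "finite cs" "finite W"
    using bs(1) cs(1) W(1) by (auto intro: independent_imp_finite)
  let ?t = "\<lambda>p. of_int (sign p) * (\<Prod>b\<in>W. representation W (L *v b) (p b))"
  have "det L = (\<Sum>p | p permutes W. ?t p)"
    using W by (rule det_eq_leibniz_sum_representation)
  also have "\<dots> = (\<Sum>p | p permutes bs. ?t p)"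
  proof (rule sum.mono_neutral_right)
    show "{p. p permutes bs} \<subseteq> {p. p permutes W}"
      by (auto simp: W_def intro: permutes_subset)
    show "\<forall>p\<in>{p. p permutes W} - {p. p permutes bs}. ?t p = 0"
    proof
      fix p assume "p \<in> {p. p permutes W} - {p. p permutes bs}"
      then have p: "p permutes W" "\<not> p permutes bs" by auto
      then obtain c where c: "c \<in> cs" "p c \<noteq> c"
        using permutes_superset[OF p(1), of bs] by (auto simp: W_def)
      then have "c \<in> W" by (simp add: W_def)
      have "L *v c = c"
        using c(1) cs(2) LF by (auto intro: span_base)
      then have "representation W (L *v c) (p c) = 0"
        using c \<open>c \<in> W\<close> W(1) by (simp add: representation_basis)
      then show "?t p = 0" using fin \<open>c \<in> W\<close> by (auto intro!: prod_zero)
    qed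
  qed (use fin in \<open>auto simp: finite_permutations\<close>)
  also have "\<dots> = (\<Sum>p | p permutes bs. of_int (sign p) *
      (\<Prod>b\<in>bs. representation bs (f b) (p b)))"
  proof (rule sum.cong)
    fix p assume "p \<in> {p. p permutes bs}"
    then have p: "p permutes bs" by simp
    have "(\<Prod>b\<in>W. representation W (L *v b) (p b)) =
        (\<Prod>b\<in>bs. representation W (L *v b) (p b)) * (\<Prod>b\<in>cs. representation W (L *v b) (p b))"
      unfolding W_def using fin disj by (intro prod.union_disjoint) auto
    also have "(\<Prod>b\<in>cs. representation W (L *v b) (p b)) = 1"
    proof (rule prod.neutral, rule)
      fix c assume c: "c \<in> cs"
      then have "p c = c" "L *v c = c"
        using p disj cs(2) LF by (auto simp: permutes_def intro: span_base)
      then show "representation W (L *v c) (p c) = 1"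
        using W(1) c by (simp add: representation_basis W_def)
    qed
    also have "(\<Prod>b\<in>bs. representation W (L *v b) (p b)) =
        (\<Prod>b\<in>bs. representation bs (f b) (p b))"
    proof (rule prod.cong)
      fix b assume "b \<in> bs"
      then have "b \<in> E" using bs(2) by (auto intro: span_base)
      then have "L *v b = f b" "f b \<in> span bs"
        using LE inv bs(2) by auto
      then show "representation W (L *v b) (p b) = representation bs (f b) (p b)"
        using representation_extend[OF W(1), of "f b" bs] by (simp add: W_def)
    qed simp
    finally show "?t p = of_int (sign p) * (\<Prod>b\<in>bs. representation bs (f b) (p b))"
      by simp
  qed simp
  finally show ?thesis
    unfolding det_on_def Let_def bs_def[symmetric] by simp
qed

text \<open>The library computes the volume of linear images only for well-ordered index types;
  hence this copy of a finite type.\<close>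

typedef 'a ranked = "UNIV :: 'a set"
  by simp

instance ranked :: (finite) finite
proof
  have "surj (Abs_ranked :: 'a \<Rightarrow> 'a ranked)"
    by (rule surjI[of _ Rep_ranked]) (rule Rep_ranked_inverse)
  then show "finite (UNIV :: 'a ranked set)"
    using finite_imageI[OF finite, of "Abs_ranked :: 'a \<Rightarrow> 'a ranked" UNIV] by simp
qed

lemma bij_Rep_ranked: "bij (Rep_ranked :: 'a ranked \<Rightarrow> 'a)"
  by (rule o_bij[of Abs_ranked]) (simp_all add: fun_eq_iff Abs_ranked_inverse Rep_ranked_inverse)

instantiation ranked :: (finite) wellorder
begin

definition rank_of :: "'a ranked \<Rightarrow> nat" where
  "rank_of i = to_nat_on (UNIV :: 'a set) (Rep_ranked i)"

definition "i \<le> j \<longleftrightarrow> rank_of i \<le> rank_of j"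

definition "i < j \<longleftrightarrow> rank_of i < rank_of j"

instance
proof
  fix i j k :: "'a ranked"
  have inj: "rank_of i = rank_of j \<Longrightarrow> i = j" for i j :: "'a ranked"
    unfolding rank_of_def
    using inj_onD[OF inj_on_to_nat_on[OF countable_finite[OF finite]],
        where x = "Rep_ranked i" and y = "Rep_ranked j"]
    by (simp add: Rep_ranked_inject)
  show "i \<le> j \<Longrightarrow> j \<le> i \<Longrightarrow> i = j"
    by (auto simp: less_eq_ranked_def intro: inj)
  show "P i" if "\<And>i. (\<And>j. j < i \<Longrightarrow> P j) \<Longrightarrow> P i" for P and i :: "'a ranked"
  proof (induction i rule: measure_induct_rule[of rank_of])
    case (less i)
    show ?case by (rule that) (rule less, simp add: less_ranked_def)
  qed
qed (auto simp: less_eq_ranked_def less_ranked_def)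

end

text \<open>Volume comparison: the balls of radius \<open>r\<close> around the images
  \<open>L *v z\<close> are disjoint, and all lie in the image of the ball of radius
  \<open>R + R'\<close>, because \<open>R'\<close> bounds the preimage of the \<open>r\<close>-ball.
  The volume of the unit ball cancels.\<close>

lemma packing_bound_wellorder:
  fixes L :: "real ^ ('n::{finite,wellorder}) ^ ('n::{finite,wellorder})" and Z :: "(real ^ 'n::{finite,wellorder}) set"
  assumes "invertible L" and "finite Z" and "R \<ge> 0" and "r > 0"
    and Z: "\<And>z. z \<in> Z \<Longrightarrow> norm z \<le> R"
    and sep: "\<And>z z'. z \<in> Z \<Longrightarrow> z' \<in> Z \<Longrightarrow> z \<noteq> z' \<Longrightarrow> 2 * r \<le> dist (L *v z) (L *v z')"
    and R': "\<And>x. norm (L *v x) \<le> r \<Longrightarrow> norm x \<le> R'"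
  shows "real (card Z) * r ^ CARD('n) \<le> \<bar>det L\<bar> * (R + R') ^ CARD('n)"
proof -
  let ?c = "unit_ball_vol (real CARD('n))"
  let ?B = "\<lambda>z. ball (L *v z) r"
  have "R' \<ge> 0" using R'[of 0] \<open>r > 0\<close> by simp
  have disj: "disjoint_family_on ?B Z"
    unfolding disjoint_family_on_def
  proof (intro ballI impI)
    fix z z' assume "z \<in> Z" "z' \<in> Z" "z \<noteq> z'"
    then show "?B z \<inter> ?B z' = {}"
      using sep[of z z'] by (intro disjoint_ballI) auto
  qed
  have sub: "(\<Union>z\<in>Z. ?B z) \<subseteq> (*v) L ` cball 0 (R + R')"
  proof
    fix y assume "y \<in> (\<Union>z\<in>Z. ?B z)"
    then obtain z where z: "z \<in> Z" "y \<in> ?B z" by auto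
    obtain L' where "L ** L' = mat 1"
      using \<open>invertible L\<close> by (auto simp: invertible_def)
    then have x: "y = L *v (L' *v y)" (is "y = L *v ?x")
      by (simp add: matrix_vector_mul_assoc)
    have "norm (L *v (?x - z)) \<le> r"
      using z x[symmetric] by (simp add: dist_norm norm_minus_commute matrix_vector_mult_diff_distrib)
    then have "norm (?x - z) \<le> R'" by (rule R')
    then have "norm ?x \<le> R + R'"
      using Z[OF z(1)] norm_triangle_ineq[of z "?x - z"] by simp
    then show "y \<in> (*v) L ` cball 0 (R + R')" using x by (intro image_eqI[of _ _ ?x]) auto
  qed
  have meas: "(\<Union>z\<in>Z. ?B z) \<in> lmeasurable"
    using \<open>finite Z\<close> by (intro fmeasurable.finite_UN lmeasurable_ball)
  have "real (card Z) * (?c * r ^ CARD('n)) = (\<Sum>z\<in>Z. measure lebesgue (?B z))"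
    using \<open>r > 0\<close> by (simp add: content_ball)
  also have "\<dots> = measure lebesgue (\<Union>z\<in>Z. ?B z)"
  proof (rule measure_finite_Union[symmetric])
    show "emeasure lebesgue (?B z) \<noteq> \<infinity>" for z
      using fmeasurableD2[OF lmeasurable_ball] by (simp add: infinity_ennreal_def)
  qed (use \<open>finite Z\<close> disj in auto)
  also have "\<dots> \<le> measure lebesgue ((*v) L ` cball 0 (R + R'))"
    using fmeasurableD[OF meas]
    by (intro measure_mono_fmeasurable[OF sub] measurable_linear_image) auto
  also have "\<dots> = \<bar>det L\<bar> * measure lebesgue (cball (0 :: real ^ ('n::{finite,wellorder})) (R + R'))"
    using measure_linear_image[OF matrix_vector_mul_linear lmeasurable_cball, of L] by simp
  also have "\<dots> = \<bar>det L\<bar> * (?c * (R + R') ^ CARD('n))"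
    using \<open>R \<ge> 0\<close> \<open>R' \<ge> 0\<close> by (simp add: content_cball)
  finally have "?c * (real (card Z) * r ^ CARD('n)) \<le> ?c * (\<bar>det L\<bar> * (R + R') ^ CARD('n))"
    by (simp add: algebra_simps)
  moreover have "?c > 0" by (rule unit_ball_vol_pos) simp
  ultimately show ?thesis by (simp add: mult_le_cancel_left_pos)
qed

text \<open>Relabelling the coordinates is a linear isometry that conjugates \<open>L\<close> to a
  matrix \<open>M\<close> with the same determinant, so the bound carries over to an arbitrary
  finite index type.\<close>

lemma packing_bound:
  fixes L :: "real ^ 'd ^ 'd"
  assumes "invertible L" and "finite Z" and "R \<ge> 0" and "r > 0"
    and Z: "\<And>z. z \<in> Z \<Longrightarrow> norm z \<le> R"
    and sep: "\<And>z z'. z \<in> Z \<Longrightarrow> z' \<in> Z \<Longrightarrow> z \<noteq> z' \<Longrightarrow> 2 * r \<le> dist (L *v z) (L *v z')"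
    and R': "\<And>x. norm (L *v x) \<le> r \<Longrightarrow> norm x \<le> R'"
  shows "real (card Z) * r ^ CARD('d) \<le> \<bar>det L\<bar> * (R + R') ^ CARD('d)"
proof -
  define \<phi> :: "real ^ 'd \<Rightarrow> real ^ 'd ranked" where "\<phi> x = (\<chi> i. x $ Rep_ranked i)" for x
  define \<psi> :: "real ^ 'd ranked \<Rightarrow> real ^ 'd" where "\<psi> y = (\<chi> i. y $ Abs_ranked i)" for y
  define M where "M = (\<chi> i j. L $ Rep_ranked i $ Rep_ranked j)"
  have inverse: "\<psi> (\<phi> x) = x" "\<phi> (\<psi> y) = y" for x y
    by (simp_all add: \<phi>_def \<psi>_def vec_eq_iff Abs_ranked_inverse Rep_ranked_inverse)
  have reindex: "(\<Sum>i\<in>UNIV. h (Rep_ranked i)) = (\<Sum>i\<in>UNIV. h i)" for h :: "'d \<Rightarrow> real"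
    by (rule sum.reindex_bij_betw[OF bij_Rep_ranked])
  have norm_\<phi>: "norm (\<phi> x) = norm x" for x
    using reindex[of "\<lambda>i. (x $ i)\<^sup>2"] by (simp add: \<phi>_def norm_vec_def L2_set_def)
  have M: "M *v \<phi> x = \<phi> (L *v x)" for x
    by (simp add: M_def \<phi>_def vec_eq_iff matrix_vector_mult_def
        reindex[of "\<lambda>j. L $ _ $ j * x $ j"])
  have diff: "\<phi> x - \<phi> y = \<phi> (x - y)" for x y
    by (simp add: \<phi>_def vec_eq_iff)
  have "inj \<phi>" by (metis injI inverse(1))
  have det: "det M = det L"
    unfolding M_def by (rule det_reindex[OF bij_Rep_ranked])
  have card: "CARD('d ranked) = CARD('d)"
    using bij_Rep_ranked by (rule bij_betw_same_card)
  have "real (card (\<phi> ` Z)) * r ^ CARD('d ranked) \<le> \<bar>det M\<bar> * (R + R') ^ CARD('d ranked)"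
  proof (rule packing_bound_wellorder)
    show "invertible M"
      using \<open>invertible L\<close> by (simp add: invertible_det_nz det)
    show "norm y \<le> R'" if "norm (M *v y) \<le> r" for y
      using R'[of "\<psi> y"] that M[of "\<psi> y"] norm_\<phi>[of "\<psi> y"] norm_\<phi>[of "L *v \<psi> y"]
      by (simp add: inverse)
    show "2 * r \<le> dist (M *v y) (M *v y')" if y: "y \<in> \<phi> ` Z" "y' \<in> \<phi> ` Z" "y \<noteq> y'" for y y'
    proof -
      obtain x x' where x: "y = \<phi> x" "y' = \<phi> x'" "x \<in> Z" "x' \<in> Z" using y by blast
      with y have "2 * r \<le> dist (L *v x) (L *v x')" by (intro sep) auto
      then show ?thesis by (simp add: x M dist_norm diff norm_\<phi>)
    qed
  qed (use assms in \<open>auto simp: norm_\<phi>\<close>)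
  also have "card (\<phi> ` Z) = card Z"
    by (rule card_image) (use \<open>inj \<phi>\<close> in \<open>auto intro: inj_on_subset\<close>)
  finally show ?thesis by (simp add: det card)
qed

section \<open>Generalized eigenspaces\<close>

lemma matpow_commute: "matpow M k ** M = M ** matpow M k"
  by (induction k) (simp_all add: matrix_mul_assoc[symmetric])

lemma matpow_Suc_vector: "matpow M (Suc k) *v v = M *v (matpow M k *v v)"
  by (simp add: matrix_vector_mul_assoc)

lemma matpow_Suc_vector': "matpow M (Suc k) *v v = matpow M k *v (M *v v)"
  by (simp add: matrix_vector_mul_assoc matpow_commute)

lemma matpow_add_vector: "matpow M (j + k) *v v = matpow M j *v (matpow M k *v v)"
  by (induction j) (simp_all only: add_0 add_Suc matpow_Suc_vector, simp)

lemma mat_mult_vector: "mat c *v v = c *s (v :: 'a::comm_semiring_1 ^ 'n)"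
  by (simp add: vec_eq_iff matrix_vector_mult_def mat_def if_distrib[of "\<lambda>x. x * _"] cong: if_cong)

lemma norm_smult: "norm (c *s v) = cmod c * norm (v :: complex ^ 'n)"
  by (simp add: norm_vec_def norm_mult L2_set_right_distrib)

lemma gen_eigenspace_0 [simp]: "0 \<in> gen_eigenspace M \<mu>"
  by (simp add: gen_eigenspace_def)

lemma gen_eigenspace_smult: "v \<in> gen_eigenspace M \<mu> \<Longrightarrow> c *s v \<in> gen_eigenspace M \<mu>"
  by (auto simp: gen_eigenspace_def vector_scalar_commute)

lemma gen_eigenspaceI:
  assumes "(M - mat \<mu>) *v v \<in> gen_eigenspace M \<mu>"
  shows "v \<in> gen_eigenspace M \<mu>"
proof -
  obtain k where "matpow (M - mat \<mu>) k *v ((M - mat \<mu>) *v v) = 0"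
    using assms by (auto simp: gen_eigenspace_def)
  then have "matpow (M - mat \<mu>) (Suc k) *v v = 0"
    by (simp only: matpow_Suc_vector')
  then show ?thesis unfolding gen_eigenspace_def by blast
qed

text \<open>Induction on the nilpotency order: a generalized eigenvector heads a chain of repeated
  images under \<open>M - mat \<mu>\<close> that ends in \<open>0\<close>.\<close>

lemma gen_eigenspace_induct [consumes 1, case_names zero step]:
  assumes "v \<in> gen_eigenspace M \<mu>" and "P 0"
    and "\<And>v. v \<in> gen_eigenspace M \<mu> \<Longrightarrow> P ((M - mat \<mu>) *v v) \<Longrightarrow> P v"
  shows "P v"
proof -
  obtain k where "matpow (M - mat \<mu>) k *v v = 0"
    using assms(1) by (auto simp: gen_eigenspace_def)
  then show ?thesis
  proof (induction k arbitrary: v)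
    case 0
    then show ?case using assms(2) by simp
  next
    case (Suc k)
    then have "matpow (M - mat \<mu>) k *v ((M - mat \<mu>) *v v) = 0"
      by (simp only: matpow_Suc_vector')
    then have "P ((M - mat \<mu>) *v v)" by (rule Suc.IH)
    moreover have "v \<in> gen_eigenspace M \<mu>"
      using Suc.prems unfolding gen_eigenspace_def by blast
    ultimately show ?case by (rule assms(3)[rotated])
  qed
qed

text \<open>The last nonzero vector of the chain is an eigenvector.\<close>

lemma gen_eigenspace_nonzero_imp_eigenvalue:
  assumes "v \<in> gen_eigenspace M \<mu>" and "v \<noteq> 0"
  shows "\<exists>w. w \<noteq> 0 \<and> M *v w = \<mu> *s w"
  using assms
proof (induction rule: gen_eigenspace_induct)
  case (step v)
  show ?case
  proof (cases "(M - mat \<mu>) *v v = 0")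
    case True
    then have "M *v v = \<mu> *s v"
      by (simp add: matrix_vector_mult_diff_rdistrib mat_mult_vector)
    with step.prems show ?thesis by blast
  qed (rule step.IH)
qed simp

lemma subspace_gen_eigenspace: "vec.subspace (gen_eigenspace M \<mu>)"
proof (rule vec.subspaceI)
  let ?N = "M - mat \<mu>"
  fix v w assume "v \<in> gen_eigenspace M \<mu>" "w \<in> gen_eigenspace M \<mu>"
  then obtain j k where v: "matpow ?N j *v v = 0" and w: "matpow ?N k *v w = 0"
    unfolding gen_eigenspace_def by blast
  have "matpow ?N (k + j) *v v = 0" "matpow ?N (j + k) *v w = 0"
    using matpow_add_vector[of ?N k j v] matpow_add_vector[of ?N j k w] by (simp_all only: v w) simp_all
  then have "matpow ?N (j + k) *v (v + w) = 0"
    by (simp only: matrix_vector_right_distrib add.commute[of k j]) simp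
  then show "v + w \<in> gen_eigenspace M \<mu>"
    unfolding gen_eigenspace_def by blast
qed (simp_all add: gen_eigenspace_smult)

text \<open>For \<open>\<nu> \<noteq> \<mu>\<close> the map \<open>M - \<nu>\<close> is onto on the generalized eigenspace of \<open>\<mu>\<close>, because
  \<open>(\<mu> - \<nu>) w = (M - \<nu>) w - (M - \<mu>) w\<close> and \<open>M - \<mu>\<close> is nilpotent there.\<close>

lemma gen_eigenspace_shift_surj:
  assumes "w \<in> gen_eigenspace M \<mu>" and "\<nu> \<noteq> \<mu>"
  shows "\<exists>v\<in>gen_eigenspace M \<mu>. (M - mat \<nu>) *v v = w"
  using assms(1)
proof (induction rule: gen_eigenspace_induct)
  case zero
  show ?case by (intro bexI[of _ 0]) simp_all
next
  case (step w)
  then obtain v where v: "v \<in> gen_eigenspace M \<mu>"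
    "(M - mat \<nu>) *v v = (M - mat \<mu>) *v w"
    by blast
  let ?u = "inverse (\<mu> - \<nu>) *s (w - v)"
  have "?u \<in> gen_eigenspace M \<mu>"
    using step.hyps v(1) by (intro gen_eigenspace_smult vec.subspace_diff subspace_gen_eigenspace)
  moreover have "(M - mat \<nu>) *v (w - v) = (\<mu> - \<nu>) *s w"
    unfolding matrix_vector_mult_diff_distrib v(2)
    by (simp add: matrix_vector_mult_diff_rdistrib mat_mult_vector vec_eq_iff algebra_simps)
  then have "(M - mat \<nu>) *v ?u = (inverse (\<mu> - \<nu>) * (\<mu> - \<nu>)) *s w"
    by (simp only: vector_scalar_commute vector_smult_assoc)
  then have "(M - mat \<nu>) *v ?u = w"
    using \<open>\<nu> \<noteq> \<mu>\<close> by simp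
  ultimately show ?case by blast
qed

section \<open>The generalized eigenspaces span the whole complex space\<close>

definition gen_eigen_span :: "complex ^ 'd ^ 'd \<Rightarrow> (complex ^ 'd) set" where
  "gen_eigen_span M = vec.span (\<Union>\<mu>. gen_eigenspace M \<mu>)"

lemma subspace_gen_eigen_span: "vec.subspace (gen_eigen_span M)"
  by (simp add: gen_eigen_span_def)

lemma gen_eigenspace_subset_span: "gen_eigenspace M \<mu> \<subseteq> gen_eigen_span M"
  unfolding gen_eigen_span_def by (blast intro: vec.span_base)

text \<open>Every \<open>w\<close> in the span \<open>?V\<close> is \<open>?N *v v'\<close> plus an
  element of the generalized eigenspace of \<nu>, with \<open>v'\<close> in \<open>?V\<close>. For
  \<open>w = ?N *v v\<close> this puts \<open>?N *v (v - v')\<close>, and with it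
  \<open>v - v'\<close>, into that eigenspace. Thus \<open>?N\<close> is injective modulo
  \<open>?V\<close>.\<close>

lemma gen_eigen_span_shift:
  assumes "(M - mat \<nu>) *v v \<in> gen_eigen_span M"
  shows "v \<in> gen_eigen_span M"
proof -
  let ?N = "M - mat \<nu>" and ?V = "gen_eigen_span M"
  have "\<exists>v'\<in>?V. w - ?N *v v' \<in> gen_eigenspace M \<nu>" if "w \<in> ?V" for w
    using that[unfolded gen_eigen_span_def]
  proof (induction rule: vec.span_induct_alt)
    case base
    show ?case
      by (intro bexI[of _ 0]) (simp_all add: vec.subspace_0[OF subspace_gen_eigen_span])
  next
    case (step c x y)
    then obtain y' \<mu> where y': "y' \<in> ?V" "y - ?N *v y' \<in> gen_eigenspace M \<nu>"
      and x: "x \<in> gen_eigenspace M \<mu>"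
      by blast
    have "\<exists>x'\<in>?V. x - ?N *v x' \<in> gen_eigenspace M \<nu>"
    proof (cases "\<mu> = \<nu>")
      case True
      with x show ?thesis
        by (intro bexI[of _ 0]) (simp_all add: vec.subspace_0[OF subspace_gen_eigen_span])
    next
      case False
      then obtain x' where "x' \<in> gen_eigenspace M \<mu>" "?N *v x' = x"
        using gen_eigenspace_shift_surj[OF x, of \<nu>] by auto
      then show ?thesis
        using subsetD[OF gen_eigenspace_subset_span] by (intro bexI[of _ x']) simp_all
    qed
    then obtain x' where x': "x' \<in> ?V" "x - ?N *v x' \<in> gen_eigenspace M \<nu>"
      by blast
    have "c *s x' + y' \<in> ?V"
      by (intro vec.subspace_add vec.subspace_scale subspace_gen_eigen_span x'(1) y'(1))
    moreover have "c *s (x - ?N *v x') + (y - ?N *v y') \<in> gen_eigenspace M \<nu>"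
      using x'(2) y'(2)
      by (intro vec.subspace_add[OF subspace_gen_eigenspace] gen_eigenspace_smult)
    moreover have "c *s (x - ?N *v x') + (y - ?N *v y') = c *s x + y - ?N *v (c *s x' + y')"
      by (simp add: matrix_vector_right_distrib vector_scalar_commute)
    ultimately show ?case by (metis (no_types))
  qed
  from this[OF assms] obtain v'
    where v': "v' \<in> ?V" "?N *v v - ?N *v v' \<in> gen_eigenspace M \<nu>"
    by blast
  from v'(2) have "?N *v (v - v') \<in> gen_eigenspace M \<nu>"
    by (simp only: matrix_vector_mult_diff_distrib)
  then have "v - v' \<in> ?V"
    by (rule subsetD[OF gen_eigenspace_subset_span gen_eigenspaceI])
  from vec.subspace_add[OF subspace_gen_eigen_span this v'(1)] show ?thesis by simp
qed

text \<open>The hypothesis says that p(M)v lies in the span. Over the complex numbers p splits, and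
  the linear factors are stripped off one at a time by \<open>gen_eigen_span_shift\<close>. The
  bound \<open>n\<close> in place of the exact degree keeps the sums in a form fit for
  induction.\<close>

lemma gen_eigen_span_poly:
  fixes p :: "complex poly"
  assumes "p \<noteq> 0" "degree p \<le> n" "(\<Sum>i\<le>n. coeff p i *s (matpow M i *v v)) \<in> gen_eigen_span M"
  shows "v \<in> gen_eigen_span M"
  using assms
proof (induction n arbitrary: p)
  case 0
  then have "coeff p 0 \<noteq> 0"
    using leading_coeff_0_iff[of p] by simp
  moreover from 0 have "coeff p 0 *s v \<in> gen_eigen_span M" by simp
  ultimately show ?case
    using vec.subspace_scale[OF subspace_gen_eigen_span, of "coeff p 0 *s v" M "inverse (coeff p 0)"]
    by simp
next
  case (Suc n)
  show ?case
  proof (cases "degree p \<le> n")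
    case True
    with Suc.prems show ?thesis by (intro Suc.IH[of p]) (simp_all add: coeff_eq_0)
  next
    case False
    then have "degree p \<noteq> 0" by simp
    then have "\<not> constant (poly p)" by (simp add: constant_degree)
    then obtain z where "poly p z = 0"
      using fundamental_theorem_of_algebra by blast
    then obtain q where q: "p = [:- z, 1:] * q"
      unfolding poly_eq_0_iff_dvd by (elim dvdE)
    with \<open>p \<noteq> 0\<close> have "q \<noteq> 0" by auto
    then have "degree p = degree [:- z, 1:] + degree q"
      unfolding q by (intro degree_mult_eq) simp_all
    with Suc.prems have deg: "degree q \<le> n" by simp
    have coeff_p: "coeff p i = coeff (pCons 0 q) i - z * coeff q i" for i
      by (simp add: q)
    \<comment> \<open>This is q(M)v. Prepending a zero coefficient amounts to applying
      \<open>M\<close>, so the sum for \<open>p\<close> becomes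
      \<open>(M - mat z) *v ?S\<close>.\<close>
    let ?S = "\<Sum>i\<le>n. coeff q i *s (matpow M i *v v)"
    have "(\<Sum>i\<le>Suc n. coeff (pCons 0 q) i *s (matpow M i *v v)) = M *v ?S"
      by (simp add: sum.atMost_Suc_shift vec.sum vector_scalar_commute matpow_Suc_vector
          del: sum.atMost_Suc matpow.simps)
    moreover have "(\<Sum>i\<le>Suc n. (z * coeff q i) *s (matpow M i *v v)) = z *s ?S"
      using deg by (simp add: vec.scale_sum_right coeff_eq_0)
    ultimately have "(\<Sum>i\<le>Suc n. coeff p i *s (matpow M i *v v)) = (M - mat z) *v ?S"
      unfolding coeff_p vec.scale_left_diff_distrib sum_subtractf
      by (simp only: matrix_vector_mult_diff_rdistrib mat_mult_vector)
    with Suc.prems(3) have "?S \<in> gen_eigen_span M"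
      by (simp add: gen_eigen_span_shift[of M z])
    with \<open>q \<noteq> 0\<close> deg show ?thesis by (rule Suc.IH)
  qed
qed

text \<open>The iterates of \<open>v\<close> at the times \<open>0\<close> to
  \<open>CARD('d)\<close> are one more than the dimension; a linear relation among them is a
  polynomial annihilating \<open>v\<close>.\<close>

lemma krylov_dependent:
  fixes M :: "complex ^ 'd ^ 'd"
  shows "\<exists>p n. p \<noteq> 0 \<and> degree p \<le> n \<and> (\<Sum>i\<le>n. coeff p i *s (matpow M i *v v)) = 0"
proof -
  define n where "n = CARD('d)"
  define x where "x i = matpow M i *v v" for i
  have "\<exists>c. (\<exists>i\<le>n. c i \<noteq> 0) \<and> (\<Sum>i\<le>n. c i *s x i) = 0"
  proof (cases "inj_on x {..n}")
    case True
    have "vec.dependent (x ` {..n})"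
    proof (rule ccontr)
      assume "\<not> vec.dependent (x ` {..n})"
      then have "card (x ` {..n}) \<le> vec.dim (UNIV :: (complex ^ 'd) set)"
        by (intro vec.independent_card_le_dim) auto
      then show False using True by (simp add: card_image n_def vec_dim_card card_cart_basis)
    qed
    then obtain u where u: "\<exists>w\<in>x ` {..n}. u w \<noteq> 0" "(\<Sum>w\<in>x ` {..n}. u w *s w) = 0"
      by (auto simp: vec.dependent_finite)
    then show ?thesis
      by (intro exI[of _ "\<lambda>i. u (x i)"]) (auto simp: sum.reindex[OF True])
  next
    case False
    then obtain i j where ij: "i \<le> n" "j \<le> n" "i \<noteq> j" "x i = x j"
      by (auto simp: inj_on_def)
    \<comment> \<open>Dependence of a set does not see repeated vectors; a repetition yields the
      relation \<open>x i - x j = 0\<close> instead.\<close>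
    let ?c = "\<lambda>k. (if k = i then 1 else 0) - (if k = j then 1 else 0 :: complex)"
    have delta: "(\<Sum>k\<le>n. (if k = l then 1 else 0) *s x k) = x l" if "l \<le> n" for l
      using that by (simp add: if_distrib[of "\<lambda>c. c *s _"] cong: if_cong)
    have "(\<Sum>k\<le>n. ?c k *s x k) = x i - x j"
      unfolding vec.scale_left_diff_distrib sum_subtractf using ij by (simp only: delta)
    with ij show ?thesis by (intro exI[of _ ?c]) auto
  qed
  then obtain c where c: "\<exists>i\<le>n. c i \<noteq> 0" "(\<Sum>i\<le>n. c i *s x i) = 0" by blast
  define p where "p = (\<Sum>i\<le>n. monom (c i) i)"
  have coeff: "coeff p i = c i" if "i \<le> n" for i
    using that by (simp add: p_def coeff_sum)
  have "p \<noteq> 0" using c(1) coeff by force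
  moreover have "degree p \<le> n"
    unfolding p_def by (rule degree_sum_le) (auto intro: order.trans[OF degree_monom_le])
  moreover have "(\<Sum>i\<le>n. coeff p i *s x i) = 0"
    using c(2) coeff by simp
  ultimately show ?thesis unfolding x_def by blast
qed

lemma gen_eigen_span_UNIV: "gen_eigen_span M = UNIV"
proof -
  have "v \<in> gen_eigen_span M" for v
  proof -
    obtain p n where p: "p \<noteq> 0" "degree p \<le> n"
      and zero: "(\<Sum>i\<le>n. coeff p i *s (matpow M i *v v)) = 0"
      using krylov_dependent by blast
    show ?thesis
      by (rule gen_eigen_span_poly[OF p]) (simp add: zero vec.subspace_0 subspace_gen_eigen_span)
  qed
  then show ?thesis by blast
qed

section \<open>Growth rates along generalized eigenvectors\<close>

lemma geometric_bound_recurrence: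
  fixes v w :: "nat \<Rightarrow> complex ^ 'd"
  assumes rec: "\<And>k. v (Suc k) = c *s v k + w k"
    and w: "\<And>k. norm (w k) \<le> C * r ^ k" and "cmod c < r"
  shows "\<exists>C'. \<forall>k. norm (v k) \<le> C' * r ^ k"
proof -
  have "r > 0" using \<open>cmod c < r\<close> norm_ge_zero[of c] by linarith
  \<comment> \<open>Chosen to cover the initial value and to satisfy
    \<open>cmod c * C' + C \<le> r * C'\<close>, which is what the induction step asks for. The gap
    between \<open>cmod c\<close> and \<open>r\<close> absorbs the inhomogeneous term.\<close>
  define C' where "C' = max (norm (v 0)) (C / (r - cmod c))"
  have C': "C \<le> (r - cmod c) * C'" "norm (v 0) \<le> C'"
    using \<open>cmod c < r\<close> by (auto simp: C'_def max_def field_simps)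
  have "norm (v k) \<le> C' * r ^ k" for k
  proof (induction k)
    case (Suc k)
    have "norm (v (Suc k)) \<le> cmod c * norm (v k) + norm (w k)"
      unfolding rec using norm_triangle_ineq[of "c *s v k" "w k"] by (simp add: norm_smult)
    also have "\<dots> \<le> cmod c * (C' * r ^ k) + (r - cmod c) * C' * r ^ k"
      using Suc w[of k] C'(1) \<open>r > 0\<close>
      by (intro add_mono mult_left_mono order.trans[OF w] mult_right_mono) auto
    finally show ?case by (simp add: algebra_simps)
  qed (use C' in simp)
  then show ?thesis by blast
qed

text \<open>Along the chain, the iterates of \<open>v\<close> satisfy a scalar recurrence with
  factor \<mu>, whose inhomogeneous term consists of the iterates of the next chain vector and is
  bounded by induction.\<close>

lemma gen_eigenspace_bound:
  assumes "v \<in> gen_eigenspace M \<mu>" and "cmod \<mu> < r"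
  shows "\<exists>C. \<forall>k. norm (matpow M k *v v) \<le> C * r ^ k"
  using assms(1)
proof (induction rule: gen_eigenspace_induct)
  case (step v)
  then obtain C where C: "\<And>k. norm (matpow M k *v ((M - mat \<mu>) *v v)) \<le> C * r ^ k"
    by blast
  have "matpow M (Suc k) *v v = \<mu> *s (matpow M k *v v) + matpow M k *v ((M - mat \<mu>) *v v)" for k
    unfolding matpow_Suc_vector'
    by (simp add: matrix_vector_mult_diff_rdistrib mat_mult_vector matrix_vector_mult_diff_distrib
        vector_scalar_commute)
  then show ?case
    by (rule geometric_bound_recurrence[where v = "\<lambda>k. matpow M k *v v"
          and w = "\<lambda>k. matpow M k *v ((M - mat \<mu>) *v v)", OF _ C assms(2)])
qed (rule exI[of _ 0], simp)

text \<open>As for \<open>M\<close>, but with factor \<open>inverse \<mu>\<close>. Solving for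
  \<open>N *v v\<close> leaves an inhomogeneous term with one further power of \<open>N\<close>,
  which costs a factor \<open>r\<close> in the constant.\<close>

lemma gen_eigenspace_bound_inverse:
  assumes "v \<in> gen_eigenspace M \<mu>" and "N ** M = mat 1" and "\<mu> \<noteq> 0" and "1 / cmod \<mu> < r"
  shows "\<exists>C. \<forall>k. norm (matpow N k *v v) \<le> C * r ^ k"
  using assms(1)
proof (induction rule: gen_eigenspace_induct)
  case (step v)
  let ?w = "(M - mat \<mu>) *v v"
  obtain C where C: "\<And>k. norm (matpow N k *v ?w) \<le> C * r ^ k"
    using step.IH by blast
  have "N *v ?w = v - \<mu> *s (N *v v)"
    by (simp add: matrix_vector_mult_diff_rdistrib mat_mult_vector matrix_vector_mult_diff_distrib
        vector_scalar_commute matrix_vector_mul_assoc assms(2))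
  then have Nv: "N *v v = inverse \<mu> *s v + (- inverse \<mu>) *s (N *v ?w)"
    using \<open>\<mu> \<noteq> 0\<close> by (simp add: vec_eq_iff field_simps)
  have rec: "matpow N (Suc k) *v v =
      inverse \<mu> *s (matpow N k *v v) + (- inverse \<mu>) *s (matpow N (Suc k) *v ?w)" for k
    unfolding matpow_Suc_vector' Nv
    by (simp only: matrix_vector_right_distrib vector_scalar_commute)
  have "norm ((- inverse \<mu>) *s (matpow N (Suc k) *v ?w)) \<le> (cmod (inverse \<mu>) * C * r) * r ^ k" for k
  proof -
    have "norm ((- inverse \<mu>) *s (matpow N (Suc k) *v ?w)) \<le> cmod (inverse \<mu>) * (C * r ^ Suc k)"
      unfolding norm_smult norm_minus_cancel by (intro mult_left_mono C) simp
    then show ?thesis by (simp add: mult_ac)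
  qed
  moreover have "cmod (inverse \<mu>) < r"
    using assms(4) by (simp add: norm_inverse divide_inverse)
  ultimately show ?case
    by (rule geometric_bound_recurrence[where v = "\<lambda>k. matpow N k *v v"
          and w = "\<lambda>k. (- inverse \<mu>) *s (matpow N (Suc k) *v ?w)", OF rec])
qed (rule exI[of _ 0], simp)

section \<open>The hyperbolic decomposition\<close>

definition Re_vec :: "complex ^ 'd \<Rightarrow> real ^ 'd" where
  "Re_vec v = (\<chi> i. Re (v $ i))"

lemma Re_vec_0 [simp]: "Re_vec 0 = 0"
  and Re_vec_add: "Re_vec (v + w) = Re_vec v + Re_vec w"
  by (simp_all add: Re_vec_def vec_eq_iff)

lemma Re_vec_of_real [simp]: "Re_vec (\<chi> i. complex_of_real (x $ i)) = x"
  by (simp add: Re_vec_def vec_eq_iff)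

lemma norm_Re_vec_le: "norm (Re_vec v) \<le> norm v"
  unfolding Re_vec_def norm_vec_def
  by (rule L2_set_mono) (simp_all add: abs_Re_le_cmod)

lemma Re_vec_cmat_mult: "Re_vec (cmat A *v v) = A *v Re_vec v"
  by (simp add: Re_vec_def matrix_vector_mult_def vec_eq_iff)

lemma Re_vec_matpow_cmat: "Re_vec (matpow (cmat A) k *v v) = matpow A k *v Re_vec v"
  by (induction k) (simp_all only: matpow_Suc_vector Re_vec_cmat_mult, simp)

lemma cmat_mult: "cmat (A ** B) = cmat A ** cmat B"
  by (simp add: matrix_matrix_mult_def vec_eq_iff)

lemma cmat_1: "cmat (mat 1) = mat 1"
  by (simp add: mat_def vec_eq_iff)

lemma real_gen_eigenspace_eq: "real_gen_eigenspace A \<mu> = Re_vec ` gen_eigenspace (cmat A) \<mu>"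
  by (simp add: real_gen_eigenspace_def Re_vec_def[abs_def])

text \<open>For \<open>A\<close> this is the stable subspace; for the inverse of \<open>A\<close> it
  contains the unstable one. A description by limits lets both be treated by the same
  lemmas.\<close>

definition contracting_subspace :: "real ^ 'd ^ 'd \<Rightarrow> (real ^ 'd) set" where
  "contracting_subspace A = {x. (\<lambda>k. matpow A k *v x) \<longlonglongrightarrow> 0}"

lemma subspace_contracting: "subspace (contracting_subspace A)"
  unfolding contracting_subspace_def
  by (rule subspaceI)
    (auto simp: matrix_vector_right_distrib matrix_vector_mult_scaleR
      intro: tendsto_add_zero tendsto_scaleR[OF tendsto_const, where b = 0, simplified])

lemma tendsto_0_geometric_bound:
  fixes v :: "nat \<Rightarrow> complex ^ 'd"
  assumes "\<And>k. norm (v k) \<le> C * r ^ k" and "0 \<le> r" "r < 1"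
  shows "(\<lambda>k. Re_vec (v k)) \<longlonglongrightarrow> 0"
proof (rule Lim_null_comparison)
  show "\<forall>\<^sub>F k in sequentially. norm (Re_vec (v k)) \<le> C * r ^ k"
    using assms(1) norm_Re_vec_le order.trans by (intro always_eventually) blast
  show "(\<lambda>k. C * r ^ k) \<longlonglongrightarrow> 0"
    using assms by (intro tendsto_mult_right_zero LIMSEQ_realpow_zero)
qed

lemma Re_gen_eigenspace_contracting:
  assumes "v \<in> gen_eigenspace (cmat A) \<mu>" and "cmod \<mu> < 1"
  shows "Re_vec v \<in> contracting_subspace A"
proof -
  obtain r where r: "cmod \<mu> < r" "r < 1" using assms(2) dense by blast
  then have "0 \<le> r" using norm_ge_zero[of \<mu>] by linarith
  obtain C where "\<And>k. norm (matpow (cmat A) k *v v) \<le> C * r ^ k"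
    using gen_eigenspace_bound[OF assms(1) r(1)] by blast
  from tendsto_0_geometric_bound[OF this \<open>0 \<le> r\<close> r(2)] show ?thesis
    by (simp add: contracting_subspace_def Re_vec_matpow_cmat)
qed

lemma Re_gen_eigenspace_contracting_inverse:
  assumes "v \<in> gen_eigenspace (cmat A) \<mu>" and "1 < cmod \<mu>" and "A' ** A = mat 1"
  shows "Re_vec v \<in> contracting_subspace A'"
proof -
  have \<mu>: "\<mu> \<noteq> 0" "1 / cmod \<mu> < 1" using assms(2) by (auto simp: divide_less_eq)
  from dense[OF \<mu>(2)] obtain r where r: "1 / cmod \<mu> < r" "r < 1" by blast
  have "0 \<le> 1 / cmod \<mu>" by simp
  with r(1) have "0 \<le> r" by linarith
  have "cmat A' ** cmat A = mat 1"
    using assms(3) by (simp flip: cmat_mult add: cmat_1)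
  then obtain C where "\<And>k. norm (matpow (cmat A') k *v v) \<le> C * r ^ k"
    using gen_eigenspace_bound_inverse[OF assms(1) _ \<mu>(1) r(1)] by blast
  from tendsto_0_geometric_bound[OF this \<open>0 \<le> r\<close> r(2)] show ?thesis
    by (simp add: contracting_subspace_def Re_vec_matpow_cmat)
qed

section \<open>The unstable subspace and its stable complement\<close>

lemma subspace_unstable: "subspace (unstable_subspace A)"
  by (simp add: unstable_subspace_def)

lemma unstable_subspace_subset_contracting:
  assumes "A' ** A = mat 1"
  shows "unstable_subspace A \<subseteq> contracting_subspace A'"
  unfolding unstable_subspace_def
proof (rule span_minimal[OF _ subspace_contracting])
  show "(\<Union>\<mu>\<in>{\<mu> \<in> spectrum A. 1 < cmod \<mu>}. real_gen_eigenspace A \<mu>) \<subseteq> contracting_subspace A'"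
    using Re_gen_eigenspace_contracting_inverse[OF _ _ assms]
    by (auto simp: real_gen_eigenspace_eq)
qed

lemma unstable_subspace_invariant:
  assumes "x \<in> unstable_subspace A"
  shows "A *v x \<in> unstable_subspace A"
proof -
  let ?S = "\<Union>\<mu>\<in>{\<mu> \<in> spectrum A. 1 < cmod \<mu>}. real_gen_eigenspace A \<mu>"
  have "A *v y \<in> ?S" if y: "y \<in> ?S" for y
  proof -
    obtain \<mu> v where \<mu>: "\<mu> \<in> spectrum A" "1 < cmod \<mu>"
      and v: "v \<in> gen_eigenspace (cmat A) \<mu>" "y = Re_vec v"
      using y unfolding real_gen_eigenspace_eq by blast
    have "cmat A *v v \<in> gen_eigenspace (cmat A) \<mu>"
    proof -
      let ?N = "cmat A - mat \<mu>"
      obtain k where "matpow ?N k *v v = 0"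
        using v(1) by (auto simp: gen_eigenspace_def)
      then have "matpow ?N k *v (?N *v v) = 0"
        by (simp only: matpow_Suc_vector[symmetric] matpow_Suc_vector'[symmetric])
          (simp only: matpow_Suc_vector matrix_vector_mult_0_right)
      then have "?N *v v \<in> gen_eigenspace (cmat A) \<mu>"
        unfolding gen_eigenspace_def by blast
      then have "?N *v v + \<mu> *s v \<in> gen_eigenspace (cmat A) \<mu>"
        using v(1) by (intro vec.subspace_add[OF subspace_gen_eigenspace] gen_eigenspace_smult)
      then show ?thesis
        by (simp add: matrix_vector_mult_diff_rdistrib mat_mult_vector)
    qed
    then have "A *v y \<in> real_gen_eigenspace A \<mu>"
      unfolding real_gen_eigenspace_eq v(2) Re_vec_cmat_mult[symmetric] by blast
    with \<mu> show ?thesis by blast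
  qed
  then have "(*v) A ` ?S \<subseteq> span ?S"
    using span_superset by blast
  then have "span ((*v) A ` ?S) \<subseteq> span ?S"
    by (rule span_minimal) simp
  then have "(*v) A ` span ?S \<subseteq> span ?S"
    by (simp only: span_linear_image[OF matrix_vector_mul_linear])
  with assms show ?thesis
    unfolding unstable_subspace_def by blast
qed

text \<open>A real vector is the real part of a sum of complex generalized eigenvectors. A nonzero
  summand belongs to an eigenvalue off the unit circle, so its real part is unstable or
  contracted.\<close>

lemma hyperbolic_decomposition:
  assumes "hyperbolic A"
  shows "\<exists>y\<in>unstable_subspace A. \<exists>z\<in>contracting_subspace A. x = y + z"
proof -
  let ?M = "cmat A"
  let ?Q = "\<lambda>v. \<exists>y\<in>unstable_subspace A. \<exists>z\<in>contracting_subspace A. Re_vec v = y + z"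
  have gen: "?Q v" if "v \<in> gen_eigenspace ?M \<mu>" for v \<mu>
  proof (cases "v = 0")
    case True
    then show ?thesis
      by (intro bexI[of _ 0]) (simp_all add: subspace_0 subspace_contracting subspace_unstable)
  next
    case False
    then have \<mu>: "\<mu> \<in> spectrum A"
      using gen_eigenspace_nonzero_imp_eigenvalue[OF that] by (simp add: spectrum_def)
    then consider "cmod \<mu> > 1" | "cmod \<mu> < 1"
      using assms by (fastforce simp: hyperbolic_def)
    then show ?thesis
    proof cases
      case 1
      have "Re_vec v \<in> unstable_subspace A"
        unfolding unstable_subspace_def
        by (rule span_base) (use \<mu> 1 that in \<open>auto simp: real_gen_eigenspace_eq\<close>)
      then show ?thesis
        by (intro bexI[of _ "Re_vec v"] bexI[of _ 0]) (simp_all add: subspace_0 subspace_contracting)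
    next
      case 2
      with Re_gen_eigenspace_contracting[OF that] show ?thesis
        by (intro bexI[of _ "Re_vec v"] bexI[of _ 0]) (simp_all add: subspace_0 subspace_unstable)
    qed
  qed
  have "?Q v" if "v \<in> vec.span (\<Union>\<mu>. gen_eigenspace ?M \<mu>)" for v
    using that
  proof (induction rule: vec.span_induct_alt)
    case base
    show ?case
      by (intro bexI[of _ 0]) (simp_all add: subspace_0 subspace_contracting subspace_unstable)
  next
    case (step c v w)
    then obtain \<mu> where "v \<in> gen_eigenspace ?M \<mu>" by blast
    \<comment> \<open>Taking real parts does not commute with complex scalars, so \<open>c\<close>
      is first absorbed into the generalized eigenvector.\<close>
    from gen[OF gen_eigenspace_smult[OF this]] obtain y z where
      "y \<in> unstable_subspace A" "z \<in> contracting_subspace A" "Re_vec (c *s v) = y + z"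
      by blast
    moreover obtain y' z' where
      "y' \<in> unstable_subspace A" "z' \<in> contracting_subspace A" "Re_vec w = y' + z'"
      using step.IH by blast
    ultimately show ?case
      by (intro bexI[of _ "y + y'"] bexI[of _ "z + z'"])
        (simp_all add: Re_vec_add subspace_add subspace_contracting subspace_unstable)
  qed
  from this[of "\<chi> i. complex_of_real (x $ i)"] show ?thesis
    using gen_eigen_span_UNIV[of ?M] by (simp add: gen_eigen_span_def)
qed

text \<open>Each vector of a finite orthonormal basis has a convergent, hence bounded, orbit, and
  the coordinates of \<open>x\<close> are at most \<open>norm x\<close>.\<close>

lemma contracting_subspace_uniform_bound:
  "\<exists>C>0. \<forall>k. \<forall>x\<in>contracting_subspace A. norm (matpow A k *v x) \<le> C * norm x"
proof -
  obtain W where W: "W \<subseteq> contracting_subspace A" "pairwise orthogonal W"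
    "\<And>b. b \<in> W \<Longrightarrow> norm b = 1" "independent W" "span W = contracting_subspace A"
    using orthonormal_basis_subspace[OF subspace_contracting[of A]] by metis
  have fin: "finite W" using W(4) by (rule independent_imp_finite)
  have "\<exists>C. \<forall>k. norm (matpow A k *v b) \<le> C" if "b \<in> W" for b
  proof -
    have "(\<lambda>k. matpow A k *v b) \<longlonglongrightarrow> 0"
      using that W(1) by (auto simp: contracting_subspace_def)
    then have "Bseq (\<lambda>k. matpow A k *v b)"
      by (intro convergent_imp_Bseq convergentI)
    then show ?thesis by (auto simp: Bseq_def)
  qed
  then obtain c where c: "\<And>b k. b \<in> W \<Longrightarrow> norm (matpow A k *v b) \<le> c b"
    by metis
  have c0: "c b \<ge> 0" if "b \<in> W" for b
    using c[OF that, of 0] norm_ge_zero order.trans by blast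
  define C where "C = 1 + (\<Sum>b\<in>W. c b)"
  have "norm (matpow A k *v x) \<le> C * norm x" if "x \<in> contracting_subspace A" for k x
  proof -
    have "x \<in> span W" using that W(5) by simp
    have coord: "\<bar>representation W x b\<bar> \<le> norm x" if "b \<in> W" for b
    proof -
      have "x = (\<Sum>a\<in>W. representation W x a *\<^sub>R a)"
        using sum_representation_eq[OF W(4) \<open>x \<in> span W\<close> fin] by simp
      then have "x \<bullet> b = (\<Sum>a\<in>W. representation W x a * (a \<bullet> b))"
        by (metis (no_types, lifting) inner_scaleR_left inner_sum_left sum.cong)
      also have "\<dots> = (\<Sum>a\<in>W. if a = b then representation W x a else 0)"
      proof (rule sum.cong)
        fix a assume "a \<in> W"
        then show "representation W x a * (a \<bullet> b) = (if a = b then representation W x a else 0)"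
          using W(2) W(3)[of a] that
          by (auto simp: pairwise_def orthogonal_def norm_eq_1)
      qed simp
      finally have "representation W x b = x \<bullet> b"
        using fin that by simp
      then show ?thesis
        using Cauchy_Schwarz_ineq2[of x b] W(3)[OF that] by simp
    qed
    have "matpow A k *v x = matpow A k *v (\<Sum>b\<in>W. representation W x b *\<^sub>R b)"
      using sum_representation_eq[OF W(4) \<open>x \<in> span W\<close> fin] by simp
    also have "\<dots> = (\<Sum>b\<in>W. representation W x b *\<^sub>R (matpow A k *v b))"
      by (simp add: linear_sum[OF matrix_vector_mul_linear] matrix_vector_mult_scaleR)
    also have "norm \<dots> \<le> (\<Sum>b\<in>W. norm (representation W x b *\<^sub>R (matpow A k *v b)))"
      by (rule norm_sum)
    also have "\<dots> \<le> (\<Sum>b\<in>W. norm x * c b)"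
      by (rule sum_mono) (use coord c c0 in \<open>auto intro!: mult_mono\<close>)
    also have "\<dots> \<le> C * norm x"
      by (simp add: C_def algebra_simps sum_distrib_left)
    finally show ?thesis .
  qed
  moreover have "C > 0"
    unfolding C_def using c0 by (intro add_pos_nonneg sum_nonneg) auto
  ultimately show ?thesis by blast
qed

lemma matpow_inverse_cancel:
  assumes "A' ** A = mat 1"
  shows "matpow A' k *v (matpow A k *v x) = x"
proof (induction k arbitrary: x)
  case (Suc k)
  have "matpow A' (Suc k) *v (matpow A (Suc k) *v x) =
      matpow A' k *v (A' *v (A *v (matpow A k *v x)))"
    unfolding matpow_Suc_vector'[of A'] matpow_Suc_vector[of A] ..
  also have "A' *v (A *v (matpow A k *v x)) = matpow A k *v x"
    by (simp only: matrix_vector_mul_assoc assms matrix_mul_assoc matrix_mul_lid)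
  also have "matpow A' k *v (matpow A k *v x) = x"
    by (rule Suc.IH)
  finally show ?case .
qed simp

text \<open>On the intersection the forward iterates are uniformly bounded, while the backward ones
  tend to zero.\<close>

lemma unstable_contracting_disjoint:
  assumes "A' ** A = mat 1" and "A ** A' = mat 1"
  shows "contracting_subspace A' \<inter> contracting_subspace A = {0}"
proof -
  obtain C where C: "C > 0"
    "\<And>k x. x \<in> contracting_subspace A \<Longrightarrow> norm (matpow A k *v x) \<le> C * norm x"
    using contracting_subspace_uniform_bound[of A] by blast
  have "x = 0" if x: "x \<in> contracting_subspace A" "x \<in> contracting_subspace A'" for x
  proof -
    \<comment> \<open>A finite delay does not affect the limit, so backward iterates are contracted
      too, and the uniform bound applies to them.\<close>
    have backward: "matpow A' k *v x \<in> contracting_subspace A" for k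
    proof -
      have "matpow A (j + k) *v (matpow A' k *v x) = matpow A j *v x" for j
        by (simp only: matpow_add_vector matpow_inverse_cancel[OF assms(2)])
      with x(1) have "(\<lambda>j. matpow A (j + k) *v (matpow A' k *v x)) \<longlonglongrightarrow> 0"
        by (simp add: contracting_subspace_def)
      then show ?thesis
        unfolding contracting_subspace_def mem_Collect_eq by (rule LIMSEQ_offset)
    qed
    have "norm x \<le> C * norm (matpow A' k *v x)" for k
      using C(2)[OF backward, of k k] by (simp only: matpow_inverse_cancel[OF assms(2)])
    moreover have "(\<lambda>k. C * norm (matpow A' k *v x)) \<longlonglongrightarrow> 0"
      using x(2) by (intro tendsto_mult_right_zero tendsto_norm_zero)
        (simp add: contracting_subspace_def)
    ultimately have "norm x \<le> 0"
      by (intro tendsto_lowerbound[of _ 0 sequentially]) auto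
    then show ?thesis by simp
  qed
  moreover have "0 \<in> contracting_subspace A" "0 \<in> contracting_subspace A'"
    by (simp_all add: subspace_0 subspace_contracting)
  ultimately show ?thesis by blast
qed

section \<open>Controls near the origin\<close>

lemma det_matpow: "det (matpow M n) = det M ^ n" for M :: "'a::comm_ring_1 ^ 'n ^ 'n"
  by (induction n) (simp_all add: det_mul)

lemma projection_onto_complement:
  fixes E F :: "'a::euclidean_space set"
  assumes E: "subspace E" and F: "subspace F" and cap: "E \<inter> F = {0}"
    and sum: "\<And>x. \<exists>y\<in>E. \<exists>z\<in>F. x = y + z"
  shows "\<exists>P. linear P \<and> (\<forall>x\<in>E. P x = x) \<and> (\<forall>x\<in>F. P x = 0)"
proof -
  obtain bs where bs: "independent bs" "span bs = E"
    using orthonormal_basis_subspace[OF E] by metis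
  obtain cs where cs: "independent cs" "span cs = F"
    using orthonormal_basis_subspace[OF F] by metis
  have W: "independent (bs \<union> cs)" "bs \<inter> cs = {}"
    using independent_Un_complementary[OF bs(1) cs(1)] cap sum by (simp_all add: bs cs)
  obtain P where P: "linear P" "\<forall>b\<in>bs \<union> cs. P b = (if b \<in> bs then b else 0)"
    using linear_independent_extend[OF W(1), of "\<lambda>b. if b \<in> bs then b else 0"] by blast
  have "P x = x" if "x \<in> E" for x
  proof (rule linear_eq_on[OF P(1) linear_ident])
    show "x \<in> span bs" using that bs(2) by simp
  qed (use P(2) in simp)
  moreover have "P x = 0" if "x \<in> F" for x
  proof (rule linear_eq_on[OF P(1) linear_zero])
    show "x \<in> span cs" using that cs(2) by simp
    show "P b = 0" if "b \<in> cs" for b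
    proof -
      have "b \<notin> bs" using that W(2) by blast
      with that show ?thesis using P(2) by simp
    qed
  qed
  ultimately show ?thesis using P(1) by blast
qed

text \<open>\<open>L\<close> acts as \<open>A\<close> on the unstable subspace and as the identity on the complementary stable
  one. Then \<open>L^n\<close> controls the first \<open>n\<close> iterates of \<open>A\<close>, since \<open>A\<close> is power bounded on the stable
  and its inverse on the unstable subspace.\<close>

lemma hyperbolic_splitting:
  fixes A :: "real ^ 'd ^ 'd"
  assumes "invertible A" and "hyperbolic A"
  obtains L :: "real ^ 'd ^ 'd" and C where "invertible L" "det L = det_unstable A" "C > 0"
    "\<And>n k z. k \<le> n \<Longrightarrow> norm (matpow A k *v z) \<le> C * norm (matpow L n *v z)"
proof -
  obtain A' where A': "A ** A' = mat 1" "A' ** A = mat 1"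
    using \<open>invertible A\<close> by (auto simp: invertible_def)
  let ?E = "unstable_subspace A" and ?F = "contracting_subspace A"
  note E = subspace_unstable[of A] and F = subspace_contracting[of A]
  have sub: "?E \<subseteq> contracting_subspace A'"
    by (rule unstable_subspace_subset_contracting[OF A'(2)])
  have cap: "?E \<inter> ?F = {0}"
    using unstable_contracting_disjoint[OF A'(2,1)] sub subspace_0[OF E] subspace_0[OF F] by blast
  note sum = hyperbolic_decomposition[OF \<open>hyperbolic A\<close>]
  obtain P where P: "linear P" "\<And>x. x \<in> ?E \<Longrightarrow> P x = x" "\<And>x. x \<in> ?F \<Longrightarrow> P x = 0"
    using projection_onto_complement[OF E F cap sum] by metis
  have P_in: "P z \<in> ?E" "z - P z \<in> ?F" for z
  proof -
    obtain y w where yw: "y \<in> ?E" "w \<in> ?F" "z = y + w" using sum[of z] by blast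
    then have "P z = y" using P by (simp add: linear_add)
    then show "P z \<in> ?E" "z - P z \<in> ?F" using yw by simp_all
  qed
  have P_eq: "P (y + w) = y" if "y \<in> ?E" "w \<in> ?F" for y w
    using that P by (simp add: linear_add)
  define L where "L = matrix (\<lambda>x. A *v P x + (x - P x))"
  have L: "L *v x = A *v P x + (x - P x)" for x
  proof -
    have "linear (\<lambda>x. A *v P x + (x - P x))"
      using P(1) linear_compose[OF P(1) matrix_vector_mul_linear[of A]]
      by (intro linear_compose_add linear_compose_sub linear_ident) (simp_all add: o_def)
    then show ?thesis unfolding L_def by (simp add: matrix_works)
  qed
  have inv: "matpow A n *v y \<in> ?E" if "y \<in> ?E" for n y
    by (induction n)
      (simp_all add: that unstable_subspace_invariant matpow_Suc_vector del: matpow.simps(2))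
  have Ln: "matpow L n *v z = matpow A n *v P z + (z - P z)" for n z
  proof (induction n)
    case (Suc n)
    have "P (matpow A n *v P z + (z - P z)) = matpow A n *v P z"
      using inv[OF P_in(1)] P_in(2) by (rule P_eq)
    then show ?case
      unfolding matpow_Suc_vector Suc L by simp
  qed simp
  obtain Kp where Kp: "Kp > 0" "\<And>x. norm (P x) \<le> Kp * norm x"
    using linear_bounded_pos[OF P(1)] by blast
  obtain Cs where Cs: "Cs > 0"
    "\<And>k x. x \<in> ?F \<Longrightarrow> norm (matpow A k *v x) \<le> Cs * norm x"
    using contracting_subspace_uniform_bound[of A] by blast
  obtain Cu where Cu: "Cu > 0"
    "\<And>k x. x \<in> contracting_subspace A' \<Longrightarrow> norm (matpow A' k *v x) \<le> Cu * norm x"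
    using contracting_subspace_uniform_bound[of A'] by blast
  \<comment> \<open>\<open>Cu * Kp\<close> accounts for projecting to the unstable part and moving
    backward from time \<open>n\<close>; \<open>Cs * (1 + Kp)\<close> for projecting to the stable
    part and moving forward from time \<open>0\<close>.\<close>
  define C where "C = Cu * Kp + Cs * (1 + Kp)"
  have "C > 0" using Kp Cs Cu by (simp add: C_def add_pos_pos)
  have bound: "norm (matpow A k *v z) \<le> C * norm (matpow L n *v z)" if "k \<le> n" for n k z
  proof -
    define q where "q = matpow L n *v z"
    have Pq: "P q = matpow A n *v P z"
      unfolding q_def Ln using inv[OF P_in(1)] P_in(2) by (rule P_eq)
    then have Qq: "q - P q = z - P z"
      unfolding q_def Ln by simp
    have "matpow A k *v P z = matpow A' (n - k) *v P q"
    proof -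
      have "matpow A n *v P z = matpow A (n - k) *v (matpow A k *v P z)"
        using that by (simp flip: matpow_add_vector)
      then show ?thesis
        unfolding Pq by (simp only: matpow_inverse_cancel[OF A'(2)])
    qed
    then have "norm (matpow A k *v P z) \<le> Cu * (Kp * norm q)"
      using Cu(2)[of "P q" "n - k"] sub P_in(1)[of q] Kp(2)[of q] Cu(1)
      by (metis mult_left_mono order.trans less_imp_le subsetD)
    moreover have "norm (matpow A k *v (z - P z)) \<le> Cs * ((1 + Kp) * norm q)"
    proof -
      have "norm (z - P z) \<le> (1 + Kp) * norm q"
        unfolding Qq[symmetric] using norm_triangle_ineq4[of q "P q"] Kp(2)[of q]
        by (simp add: algebra_simps)
      then have "Cs * norm (z - P z) \<le> Cs * ((1 + Kp) * norm q)"
        using Cs(1) by (intro mult_left_mono) simp_all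
      with Cs(2)[OF P_in(2)[of z], of k] show ?thesis by linarith
    qed
    moreover have "matpow A k *v z = matpow A k *v P z + matpow A k *v (z - P z)"
      by (simp flip: matrix_vector_right_distrib)
    then have "norm (matpow A k *v z) \<le>
        norm (matpow A k *v P z) + norm (matpow A k *v (z - P z))"
      by (simp only: norm_triangle_ineq)
    moreover have "C * norm q = Cu * (Kp * norm q) + Cs * ((1 + Kp) * norm q)"
      by (simp add: C_def algebra_simps)
    ultimately show ?thesis
      unfolding q_def[symmetric] by linarith
  qed
  \<comment> \<open>The bound with \<open>k = 0\<close> and \<open>n = 1\<close> reads
    \<open>norm z \<le> C * norm (L *v z)\<close>, up to \<open>matpow\<close>.\<close>
  have "inj ((*v) L)"
  proof (rule injI)
    fix x y assume "L *v x = L *v y"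
    then have "matpow L 1 *v (x - y) = 0"
      by (simp add: matrix_vector_mult_diff_distrib)
    with bound[of 0 1 "x - y"] show "x = y" by simp
  qed
  then have "invertible L"
    using det_nz_iff_inj[OF matrix_vector_mul_linear[of L]] by (simp add: invertible_det_nz)
  moreover have "det L = det_unstable A"
    unfolding det_unstable_def
    by (rule det_on_eq_det[OF E F cap sum, symmetric])
      (simp_all add: L P unstable_subspace_invariant)
  ultimately show ?thesis
    using \<open>C > 0\<close> bound by (rule that)
qed

text \<open>A largest set that is \<open>2 * r\<close>-separated after \<open>matpow L n\<close> is
  also a \<open>2 * r\<close>-net there. By \<open>bound\<close>, closeness under this single matrix
  forces closeness of all iterates of \<open>A\<close> up to \<open>n\<close>; the packing bound
  limits the cardinality.\<close>

lemma bowen_cover: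
  fixes A L :: "real ^ 'd ^ 'd"
  assumes "invertible L" and "C > 0" and "R \<ge> 0" and "\<eta> > 0"
    and bound: "\<And>n k z. k \<le> n \<Longrightarrow> norm (matpow A k *v z) \<le> C * norm (matpow L n *v z)"
  shows "\<exists>K\<ge>0. \<forall>n. \<exists>Z. finite Z \<and> real (card Z) \<le> K * \<bar>det L\<bar> ^ n \<and> Z \<subseteq> cball 0 R \<and>
    (\<forall>z\<in>cball 0 R. \<exists>z'\<in>Z. \<forall>k\<le>n. norm (matpow A k *v (z - z')) \<le> \<eta>)"
proof -
  \<comment> \<open>Then \<open>C * (2 * r) = \<eta>\<close>. The case \<open>k = 0\<close> of
    \<open>bound\<close> gives \<open>C * r\<close> as the radius \<open>R'\<close> in the packing
    bound.\<close>
  define r where "r = \<eta> / (2 * C)"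
  define K where "K = (R + C * r) ^ CARD('d) / r ^ CARD('d)"
  have "r > 0" using assms by (simp add: r_def)
  have "K \<ge> 0" using assms \<open>r > 0\<close> by (simp add: K_def)
  have "\<exists>Z. finite Z \<and> real (card Z) \<le> K * \<bar>det L\<bar> ^ n \<and> Z \<subseteq> cball 0 R \<and>
    (\<forall>z\<in>cball 0 R. \<exists>z'\<in>Z. \<forall>k\<le>n. norm (matpow A k *v (z - z')) \<le> \<eta>)" for n
  proof -
    let ?L = "matpow L n"
    define Sep where "Sep Z \<longleftrightarrow> finite Z \<and> Z \<subseteq> cball 0 R \<and>
      (\<forall>z\<in>Z. \<forall>z'\<in>Z. z \<noteq> z' \<longrightarrow> 2 * r \<le> dist (?L *v z) (?L *v z'))" for Z
    have det: "det ?L = det L ^ n" by (rule det_matpow)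
    have inv: "invertible ?L"
      using \<open>invertible L\<close> by (simp add: invertible_det_nz det)
    have card: "real (card Z) \<le> K * \<bar>det L\<bar> ^ n" if Z: "Sep Z" for Z
    proof -
      have "real (card Z) * r ^ CARD('d) \<le> \<bar>det ?L\<bar> * (R + C * r) ^ CARD('d)"
      proof (rule packing_bound[OF inv _ \<open>R \<ge> 0\<close> \<open>r > 0\<close>])
        show "norm x \<le> C * r" if "norm (?L *v x) \<le> r" for x
          using order.trans[OF bound[of 0 n x] mult_left_mono[OF that]] \<open>C > 0\<close> by simp
      qed (use Z in \<open>auto simp: Sep_def\<close>)
      then show ?thesis
        using \<open>r > 0\<close> by (simp add: K_def det power_abs field_simps)
    qed
    have "Sep {}" by (simp add: Sep_def)
    \<comment> \<open>The packing bound is used twice: it makes a separated set of largest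
      cardinality exist, and it bounds that cardinality.\<close>
    moreover have "\<forall>Z. Sep Z \<longrightarrow> card Z < Suc (nat \<lfloor>K * \<bar>det L\<bar> ^ n\<rfloor>)"
      using card by (simp add: le_nat_floor less_Suc_eq_le)
    ultimately have "\<exists>Z. Sep Z \<and> (\<forall>Z'. Sep Z' \<longrightarrow> card Z' \<le> card Z)"
      by (rule ex_has_greatest_nat)
    then obtain Z where Z: "Sep Z" and max: "\<And>Z'. Sep Z' \<Longrightarrow> card Z' \<le> card Z"
      by blast
    have "\<exists>z'\<in>Z. \<forall>k\<le>n. norm (matpow A k *v (z - z')) \<le> \<eta>" if z: "z \<in> cball 0 R" for z
    proof -
      have "\<exists>z'\<in>Z. dist (?L *v z) (?L *v z') < 2 * r"
      proof (rule ccontr)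
        assume "\<not> ?thesis"
        then have far: "2 * r \<le> dist (?L *v z) (?L *v z')" if "z' \<in> Z" for z'
          using that by force
        then have "z \<notin> Z" using \<open>r > 0\<close> by force
        have "Sep (insert z Z)"
          using Z z far by (auto simp: Sep_def dist_commute)
        from max[OF this] \<open>z \<notin> Z\<close> Z show False by (simp add: Sep_def)
      qed
      then obtain z' where z': "z' \<in> Z" "norm (?L *v (z - z')) \<le> 2 * r"
        by (auto simp: dist_norm matrix_vector_mult_diff_distrib less_imp_le)
      have "norm (matpow A k *v (z - z')) \<le> \<eta>" if "k \<le> n" for k
        using bound[OF that, of "z - z'"] mult_left_mono[OF z'(2), of C] \<open>C > 0\<close>
        by (simp add: r_def)
      with z'(1) show ?thesis by blast
    qed
    with Z card[OF Z] show ?thesis unfolding Sep_def by blast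
  qed
  with \<open>K \<ge> 0\<close> show ?thesis by blast
qed

section \<open>Controllability and small null controls\<close>

lemma linear_family_bounded:
  fixes h :: "nat \<Rightarrow> 'a::euclidean_space \<Rightarrow> 'b::real_normed_vector"
  assumes "\<And>k. linear (h k)"
  shows "\<exists>C>0. \<forall>k\<le>n. \<forall>x. norm (h k x) \<le> C * norm x"
proof (induction n)
  case 0
  then show ?case using linear_bounded_pos[OF assms[of 0]] by auto
next
  case (Suc n)
  then obtain C where C: "C > 0" "\<And>k x. k \<le> n \<Longrightarrow> norm (h k x) \<le> C * norm x" by blast
  obtain C' where C': "C' > 0" "\<And>x. norm (h (Suc n) x) \<le> C' * norm x"
    using linear_bounded_pos[OF assms[of "Suc n"]] by blast
  have "norm (h k x) \<le> max C C' * norm x" if "k \<le> Suc n" for k x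
  proof -
    have "norm (h k x) \<le> C * norm x \<or> norm (h k x) \<le> C' * norm x"
      using that C(2)[of k x] C'(2)[of x] by (auto simp: le_Suc_eq)
    then show ?thesis
      by (auto simp: max_mult_distrib_right)
  qed
  then show ?case using C(1) by (intro exI[of _ "max C C'"]) auto
qed

lemma kalman_matrix_mult:
  fixes A :: "real ^ 'd ^ 'd" and B :: "real ^ 'm ^ 'd"
  shows "kalman_matrix A B *v y = (\<Sum>k\<in>UNIV. matpow A (to_nat_on (UNIV :: 'd set) k) *v
    (B *v (\<chi> j. y $ (k, j))))"
proof -
  have "(kalman_matrix A B *v y) $ i = (\<Sum>k\<in>UNIV. matpow A (to_nat_on (UNIV :: 'd set) k) *v
    (B *v (\<chi> j. y $ (k, j)))) $ i" for i
  proof -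
    have "(kalman_matrix A B *v y) $ i = (\<Sum>(k, j)\<in>UNIV \<times> UNIV.
        (matpow A (to_nat_on (UNIV :: 'd set) k) ** B) $ i $ j * y $ (k, j))"
      by (simp add: kalman_matrix_def matrix_vector_mult_def case_prod_beta)
    also have "\<dots> = (\<Sum>k\<in>UNIV. \<Sum>j\<in>UNIV.
        (matpow A (to_nat_on (UNIV :: 'd set) k) ** B) $ i $ j * y $ (k, j))"
      by (rule sum.cartesian_product[symmetric])
    also have "\<dots> = (\<Sum>k\<in>UNIV. ((matpow A (to_nat_on (UNIV :: 'd set) k) ** B) *v
        (\<chi> j. y $ (k, j))) $ i)"
      by (simp add: matrix_vector_mult_def)
    finally show ?thesis
      by (simp add: matrix_vector_mul_assoc)
  qed
  then show ?thesis by (simp add: vec_eq_iff)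
qed

text \<open>A linear right inverse of the Kalman matrix yields a control, linear in
  \<open>z\<close>, that reaches \<open>0\<close> at time \<open>CARD('d)\<close>; the zero control
  then keeps the state there. So only finitely many linear maps have to be bounded.\<close>

lemma controllable_null_control:
  fixes A :: "real ^ 'd ^ 'd" and B :: "real ^ 'm ^ 'd"
  assumes "controllable A B"
  shows "\<exists>C>0. \<exists>w. \<forall>z. (\<forall>k. norm (w z k) \<le> C * norm z) \<and>
    (\<forall>k. norm (sol A B k z (w z)) \<le> C * norm z)"
proof -
  let ?d = "CARD('d)" and ?idx = "to_nat_on (UNIV :: 'd set)"
  have "surj ((*v) (kalman_matrix A B))"
    using assms by (simp add: controllable_def full_rank_surjective)
  then obtain G where G: "linear G" "(*v) (kalman_matrix A B) \<circ> G = id"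
    using linear_surjective_right_inverse[OF matrix_vector_mul_linear] by blast
  have idx: "bij_betw ?idx UNIV {..<?d}"
    by (rule to_nat_on_finite) simp
  define e where "e = inv_into UNIV ?idx"
  have e: "e (?idx k) = k" for k
    unfolding e_def using idx by (simp add: bij_betw_def)
  define y where "y z i = (\<chi> j. G (matpow A ?d *v z) $ (e i, j))" for z i
  \<comment> \<open>Block \<open>i\<close> multiplies \<open>A^i B\<close>, the effect at time
    \<open>?d\<close> of the control value at time \<open>?d - 1 - i\<close>; hence the reversed
    index. The sign cancels the free motion \<open>matpow A ?d *v z\<close>.\<close>
  define w where "w z i = (if i < ?d then - y z (?d - 1 - i) else 0)" for z i
  have lin_G: "linear (\<lambda>z. G (matpow A ?d *v z))"
    using linear_compose[OF matrix_vector_mul_linear G(1)] by (simp add: o_def)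
  have w_add: "w (z + z') = (\<lambda>i. w z i + w z' i)" for z z'
    by (rule ext) (simp add: w_def y_def linear_add[OF lin_G] vec_eq_iff)
  have w_scale: "w (c *\<^sub>R z) = (\<lambda>i. c *\<^sub>R w z i)" for c z
    by (rule ext) (simp add: w_def y_def linear_scale[OF lin_G] vec_eq_iff)
  have lin_w: "linear (\<lambda>z. w z k)" for k
    by (rule linearI) (simp_all only: w_add w_scale)
  have lin_sol: "linear (\<lambda>z. sol A B k z (w z))" for k
  proof (rule linearI)
    fix z z' c
    show "sol A B k (z + z') (w (z + z')) = sol A B k z (w z) + sol A B k z' (w z')"
      unfolding w_add by (rule sol_plus)
    show "sol A B k (c *\<^sub>R z) (w (c *\<^sub>R z)) = c *\<^sub>R sol A B k z (w z)"
      unfolding w_scale by (rule sol_scaleR)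
  qed
  obtain C1 where C1: "C1 > 0" "\<forall>k\<le>?d. \<forall>z. norm (w z k) \<le> C1 * norm z"
    using linear_family_bounded[where h = "\<lambda>k z. w z k" and n = ?d, OF lin_w] by blast
  obtain C2 where C2: "C2 > 0" "\<forall>k\<le>?d. \<forall>z. norm (sol A B k z (w z)) \<le> C2 * norm z"
    using linear_family_bounded[where h = "\<lambda>k z. sol A B k z (w z)" and n = ?d, OF lin_sol] by blast
  have zero_d: "sol A B ?d z (w z) = 0" for z
  proof -
    have "matpow A ?d *v z = kalman_matrix A B *v G (matpow A ?d *v z)"
      using fun_cong[OF G(2), of "matpow A ?d *v z"] by simp
    also have "\<dots> = (\<Sum>k\<in>UNIV. matpow A (?idx k) *v (B *v y z (?idx k)))"
      by (simp add: kalman_matrix_mult y_def e)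
    also have "\<dots> = (\<Sum>i<?d. matpow A i *v (B *v y z i))"
      by (rule sum.reindex_bij_betw[OF idx])
    also have "\<dots> = (\<Sum>i<?d. matpow A (?d - 1 - i) *v (B *v y z (?d - 1 - i)))"
      by (subst sum.nat_diff_reindex[symmetric]) simp
    also have "\<dots> = - (\<Sum>i<?d. matpow A (?d - 1 - i) *v (B *v w z i))"
      unfolding sum_negf[symmetric]
      by (rule sum.cong) (simp_all add: w_def linear_neg[OF matrix_vector_mul_linear])
    finally show ?thesis by (simp add: sol_def)
  qed
  have zero: "sol A B k z (w z) = 0" if "?d \<le> k" for k z
    using that
  proof (induction k rule: dec_induct)
    case (step k)
    then show ?case by (simp add: w_def)
  qed (rule zero_d)
  define C where "C = C1 + C2"
  have le: "C1 * norm z \<le> C * norm z" "C2 * norm z \<le> C * norm z" for z :: "real ^ 'd"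
    using C1 C2 by (simp_all add: C_def algebra_simps)
  have "norm (w z k) \<le> C * norm z" for z k
  proof (cases "k \<le> ?d")
    case True
    then show ?thesis using C1(2)[rule_format, of k z] le(1)[of z] by linarith
  next
    case False
    then show ?thesis using C1(1) C2(1) by (simp add: w_def C_def)
  qed
  moreover have "norm (sol A B k z (w z)) \<le> C * norm z" for z k
  proof (cases "k \<le> ?d")
    case True
    then show ?thesis using C2(2)[rule_format, of k z] le(2)[of z] by linarith
  next
    case False
    then show ?thesis using C1(1) C2(1) by (simp add: zero C_def)
  qed
  moreover have "C > 0" using C1 C2 by (simp add: C_def)
  ultimately show ?thesis by blast
qed

text \<open>The tolerance is halved: one half for the null-controlled trajectory of the centre
  \<open>z'\<close>, the other for the free motion of \<open>z - z'\<close>. Neither \<rho> nor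
  \<open>K\<close> depends on \<open>n\<close>.\<close>

lemma local_spanning_controls:
  fixes A :: "real ^ 'd ^ 'd" and B :: "real ^ 'm ^ 'd"
  assumes "invertible A" "hyperbolic A" "controllable A B" and "\<epsilon> > 0"
  obtains \<rho> K where "\<rho> > 0" "K \<ge> 0"
    "\<And>n. \<exists>S. finite S \<and> real (card S) \<le> K * \<bar>det_unstable A\<bar> ^ n \<and>
      (\<forall>w\<in>S. \<forall>k. norm (w k) \<le> \<epsilon>) \<and>
      (\<forall>z\<in>cball 0 \<rho>. \<exists>w\<in>S. \<forall>k\<le>n. norm (sol A B k z w) \<le> \<epsilon>)"
proof -
  obtain L :: "real ^ 'd ^ 'd" and C where L: "invertible L" "det L = det_unstable A" "C > 0"
    "\<And>n k z. k \<le> n \<Longrightarrow> norm (matpow A k *v z) \<le> C * norm (matpow L n *v z)"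
    using hyperbolic_splitting[OF assms(1,2)] by metis
  obtain C' w where C': "C' > 0" "\<And>z k. norm (w z k) \<le> C' * norm z"
    "\<And>z k. norm (sol A B k z (w z)) \<le> C' * norm z"
    using controllable_null_control[OF assms(3)] by metis
  define \<rho> where "\<rho> = \<epsilon> / (2 * C')"
  have \<rho>: "\<rho> > 0" "C' * norm z \<le> \<epsilon> / 2" if "norm z \<le> \<rho>" for z :: "real ^ 'd"
    using that mult_left_mono[OF that, of C'] C'(1) \<open>\<epsilon> > 0\<close> by (simp_all add: \<rho>_def)
  have "\<rho> > 0" using C'(1) \<open>\<epsilon> > 0\<close> by (simp add: \<rho>_def)
  have "\<epsilon> / 2 > 0" using \<open>\<epsilon> > 0\<close> by simp
  obtain K where "K \<ge> 0" and K: "\<And>n. \<exists>Z. finite Z \<and> real (card Z) \<le> K * \<bar>det L\<bar> ^ n \<and>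
    Z \<subseteq> cball 0 \<rho> \<and> (\<forall>z\<in>cball 0 \<rho>. \<exists>z'\<in>Z. \<forall>k\<le>n. norm (matpow A k *v (z - z')) \<le> \<epsilon> / 2)"
    using bowen_cover[OF L(1,3) less_imp_le[OF \<open>\<rho> > 0\<close>] \<open>\<epsilon> / 2 > 0\<close> L(4)] by metis
  have "\<exists>S. finite S \<and> real (card S) \<le> K * \<bar>det_unstable A\<bar> ^ n \<and>
      (\<forall>w\<in>S. \<forall>k. norm (w k) \<le> \<epsilon>) \<and>
      (\<forall>z\<in>cball 0 \<rho>. \<exists>w\<in>S. \<forall>k\<le>n. norm (sol A B k z w) \<le> \<epsilon>)" for n
  proof -
    obtain Z where Z: "finite Z" "real (card Z) \<le> K * \<bar>det L\<bar> ^ n" "Z \<subseteq> cball 0 \<rho>"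
      and cover: "\<And>z. z \<in> cball 0 \<rho> \<Longrightarrow>
        \<exists>z'\<in>Z. \<forall>k\<le>n. norm (matpow A k *v (z - z')) \<le> \<epsilon> / 2"
      using K[of n] by metis
    have "real (card (w ` Z)) \<le> K * \<bar>det_unstable A\<bar> ^ n"
      using Z(2) card_image_le[OF Z(1), of w] by (simp add: L(2))
    moreover have "norm (w z k) \<le> \<epsilon>" if "z \<in> Z" for z k
    proof -
      have "norm z \<le> \<rho>" using that Z(3) by auto
      from \<rho>(2)[OF this] C'(2)[of z k] \<open>\<epsilon> > 0\<close> show ?thesis by linarith
    qed
    moreover have "\<exists>w\<in>w ` Z. \<forall>k\<le>n. norm (sol A B k z w) \<le> \<epsilon>" if z: "z \<in> cball 0 \<rho>" for z
    proof -
      obtain z' where z': "z' \<in> Z" "\<And>k. k \<le> n \<Longrightarrow> norm (matpow A k *v (z - z')) \<le> \<epsilon> / 2"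
        using cover[OF z] by blast
      then have "norm z' \<le> \<rho>" using Z(3) by auto
      have "norm (sol A B k z (w z')) \<le> \<epsilon>" if "k \<le> n" for k
      proof -
        have "sol A B k z (w z') = sol A B k z' (w z') + matpow A k *v (z - z')"
          using sol_plus[of A B k z' "z - z'" "w z'" "\<lambda>_. 0"] by (simp add: sol_zero_control)
        then have "norm (sol A B k z (w z')) \<le>
            norm (sol A B k z' (w z')) + norm (matpow A k *v (z - z'))"
          by (simp only: norm_triangle_ineq)
        then show ?thesis
          using z'(2)[OF that] C'(3)[of k z'] \<rho>(2)[OF \<open>norm z' \<le> \<rho>\<close>]
          by linarith
      qed
      with z'(1) show ?thesis by blast
    qed
    ultimately show ?thesis
      using Z(1) by (intro exI[of _ "w ` Z"]) blast
  qed
  with \<open>\<rho> > 0\<close> \<open>K \<ge> 0\<close> show ?thesis by (rule that)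
qed

section \<open>The pressure estimate\<close>

lemma ln_ennreal_le:
  assumes "a \<le> ennreal y" and "y > 0"
  shows "ln_ennreal a \<le> ereal (ln y)"
proof (cases "a = 0")
  case False
  have "a < \<infinity>" 
    using le_less_trans[OF assms(1) ennreal_less_top] by (simp add: infinity_ennreal_def)
  have "enn2real a \<le> y"
    using assms enn2real_mono[OF assms(1)] by simp
  moreover have "enn2real a > 0"
    using False \<open>a < \<infinity>\<close> by (simp add: enn2real_positive_iff zero_less_iff_neq_zero infinity_ennreal_def)
  ultimately show ?thesis
    using False \<open>a < \<infinity>\<close> by (simp add: ln_ennreal_def)
qed (simp add: ln_ennreal_def)

text \<open>After the logarithm and division by \<open>n\<close>, the constants \<open>c\<close> and
  \<open>C\<close> contribute only \<open>(ln c + C) / real n\<close>, which tends to zero.\<close>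

lemma P_tot_le:
  assumes "c > 0" and "q > 0"
    and bound: "\<And>n. n \<ge> N \<Longrightarrow> a_tot A B U f K D n \<le> ennreal (c * q ^ n * exp (real n * b + C))"
  shows "P_tot A B U f K D \<le> ereal (ln q + b)"
proof -
  let ?g = "\<lambda>n. ereal ((ln c + C) / real n + (ln q + b))"
  have "ereal (1 / real n) * ln_ennreal (a_tot A B U f K D n) \<le> ?g n" if n: "n \<ge> max N 1" for n
  proof -
    have "ln_ennreal (a_tot A B U f K D n) \<le> ereal (ln (c * q ^ n * exp (real n * b + C)))"
      using n \<open>c > 0\<close> \<open>q > 0\<close> by (intro ln_ennreal_le bound) simp_all
    also have "ln (c * q ^ n * exp (real n * b + C)) = ln c + real n * ln q + (real n * b + C)"
      using \<open>c > 0\<close> \<open>q > 0\<close> by (simp add: ln_mult ln_realpow)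
    finally have "ereal (1 / real n) * ln_ennreal (a_tot A B U f K D n) \<le>
        ereal (1 / real n) * ereal (ln c + real n * ln q + (real n * b + C))"
      by (rule ereal_mult_left_mono) simp
    also have "\<dots> = ?g n"
      using n by (simp add: field_simps)
    finally show ?thesis .
  qed
  then have "P_tot A B U f K D \<le> limsup ?g"
    unfolding P_tot_def by (intro Limsup_mono eventually_sequentiallyI[of "max N 1"])
  also have "limsup ?g = ereal (ln q + b)"
  proof (rule lim_imp_Limsup)
    have "(\<lambda>n. (ln c + C) / real n + (ln q + b)) \<longlonglongrightarrow> 0 + (ln q + b)"
      by (intro tendsto_add tendsto_const lim_const_over_n)
    then show "?g \<longlonglongrightarrow> ereal (ln q + b)" by simp
  qed simp
  finally show ?thesis .
qed

lemma a_tot_le: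
  assumes "finite S" and "real (card S) \<le> c" and "spanning A B U n K D S"
    and \<xi>: "\<And>u. u \<in> S \<Longrightarrow> \<xi> u \<in> K" "\<And>u k. u \<in> S \<Longrightarrow> k \<in> {1..n} \<Longrightarrow> sol A B k (\<xi> u) u \<in> D"
    and b: "\<And>u. u \<in> S \<Longrightarrow> birkhoff_sum A B f n (\<xi> u) u \<le> b"
  shows "a_tot A B U f K D n \<le> ennreal (c * exp b)"
proof -
  let ?S = "(\<lambda>u. (\<xi> u, u)) ` S"
  let ?F = "\<lambda>(x, u). ennreal (exp (birkhoff_sum A B f n x u))"
  have "totally_spanning A B U n K D ?S"
    unfolding totally_spanning_def
    by (rule exI[of _ S], rule exI[of _ \<xi>]) (use assms in auto)
  then have "a_tot A B U f K D n \<le> infsum ?F ?S"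
    unfolding a_tot_def by (intro INF_lower) simp
  also have "infsum ?F ?S = sum ?F ?S"
    using \<open>finite S\<close> by simp
  also have "\<dots> \<le> (\<Sum>p\<in>?S. ennreal (exp b))"
    using b by (intro sum_mono) (auto intro!: ennreal_leI)
  also have "\<dots> = ennreal (real (card ?S) * exp b)"
    by (simp add: ennreal_mult ennreal_of_nat_eq_real_of_nat)
  also have "\<dots> \<le> ennreal (c * exp b)"
  proof (rule ennreal_leI, rule mult_right_mono)
    show "real (card ?S) \<le> c"
      using card_image_le[OF \<open>finite S\<close>, of "\<lambda>u. (\<xi> u, u)"] assms(2) by linarith
  qed simp
  finally show ?thesis .
qed

section \<open>Periodic averages and estimates along the orbit\<close>

lemma sum_lessThan_add:
  fixes g :: "nat \<Rightarrow> 'a::comm_monoid_add"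
  shows "(\<Sum>i<k + m. g i) = (\<Sum>i<k. g i) + (\<Sum>i<m. g (k + i))"
  by (induction m) (simp_all add: add.assoc)

lemma periodic_eq_mod:
  assumes "\<And>i. g (i + p) = g (i::nat)"
  shows "g i = g (i mod p)"
proof (induction i rule: less_induct)
  case (less i)
  show ?case
  \<comment> \<open>In the other case \<open>i mod p = i\<close>, also for
    \<open>p = 0\<close>.\<close>
  proof (cases "p \<le> i \<and> p > 0")
    case True
    then have "g i = g (i - p)" using assms[of "i - p"] by simp
    also have "\<dots> = g ((i - p) mod p)" using True by (intro less) simp
    finally show ?thesis using True by (simp add: le_mod_geq)
  qed auto
qed

text \<open>The deviation \<open>h\<close> of the partial sums from linear growth is itself
  periodic, hence bounded by its values over one period.\<close>

lemma periodic_sum_bound: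
  fixes g :: "nat \<Rightarrow> real"
  assumes per: "\<And>i. g (i + p) = g i" and "p > 0"
  shows "\<exists>C\<ge>0. \<forall>m. (\<Sum>i<m. g i) \<le> real m * ((1 / real p) * (\<Sum>i<p. g i)) + C"
proof -
  define a where "a = (1 / real p) * (\<Sum>i<p. g i)"
  define h where "h m = (\<Sum>i<m. g i) - real m * a" for m
  have per': "g (p + i) = g i" for i using per[of i] by (simp add: add.commute)
  have "h (m + p) = h m" for m
  proof -
    have "(\<Sum>i<p + m. g i) = real p * a + (\<Sum>i<m. g i)"
      using \<open>p > 0\<close> by (simp add: sum_lessThan_add a_def per')
    then show ?thesis by (simp add: h_def algebra_simps)
  qed
  from periodic_eq_mod[of h, OF this] have h_mod: "h m = h (m mod p)" for m .
  have "h m \<le> (\<Sum>j<p. \<bar>h j\<bar>)" for m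
  proof -
    have "m mod p < p" using \<open>p > 0\<close> by simp
    then have "\<bar>h (m mod p)\<bar> \<le> (\<Sum>j<p. \<bar>h j\<bar>)"
      by (intro member_le_sum) auto
    then show ?thesis using h_mod[of m] by linarith
  qed
  then show ?thesis
    by (intro exI[of _ "\<Sum>j<p. \<bar>h j\<bar>"]) (auto simp: h_def a_def algebra_simps sum_nonneg)
qed

lemma uniform_radius:
  fixes Q :: "nat \<Rightarrow> real \<Rightarrow> bool"
  assumes "\<And>i. i < n \<Longrightarrow> \<exists>e>0. Q i e"
    and mono: "\<And>i d e. 0 < d \<Longrightarrow> d \<le> e \<Longrightarrow> Q i e \<Longrightarrow> Q i d"
  shows "\<exists>e>0. \<forall>i<n. Q i e"
  using assms(1)
proof (induction n)
  case 0
  show ?case by (intro exI[of _ 1]) simp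
next
  case (Suc n)
  then obtain e where e: "e > 0" "\<And>i. i < n \<Longrightarrow> Q i e" by (meson less_Suc_eq)
  obtain e' where e': "e' > 0" "Q n e'" using Suc.prems by blast
  have "Q i (min e e')" if "i < Suc n" for i
  proof (cases "i = n")
    case True
    then show ?thesis using mono[of "min e e'" e' n] e e' by simp
  next
    case False
    then show ?thesis using mono[of "min e e'" e i] e e' that by simp
  qed
  then show ?case using e e' by (intro exI[of _ "min e e'"]) simp
qed

lemma continuous_near_interior_point:
  fixes f :: "'a::euclidean_space \<times> 'b::euclidean_space \<Rightarrow> real"
  assumes "continuous_on (closure D \<times> U) f" and "x \<in> interior D" and "u \<in> interior U" and "\<gamma> > 0"
  shows "\<exists>e>0. \<forall>y v. dist y x \<le> e \<and> dist v u \<le> e \<longrightarrow>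
    y \<in> D \<and> v \<in> U \<and> f (y, v) \<le> f (x, u) + \<gamma>"
proof -
  obtain e1 where e1: "e1 > 0" "cball x e1 \<subseteq> D"
    using assms(2) by (auto simp: mem_interior_cball)
  obtain e2 where e2: "e2 > 0" "cball u e2 \<subseteq> U"
    using assms(3) by (auto simp: mem_interior_cball)
  have "(x, u) \<in> closure D \<times> U"
    using subsetD[OF interior_subset assms(2)] subsetD[OF interior_subset assms(3)]
    by (simp add: subsetD[OF closure_subset])
  then obtain d where d: "d > 0"
    "\<And>z. z \<in> closure D \<times> U \<Longrightarrow> dist z (x, u) < d \<Longrightarrow> dist (f z) (f (x, u)) < \<gamma>"
    using assms(1) \<open>\<gamma> > 0\<close> unfolding continuous_on_iff by blast
  \<comment> \<open>A third of \<open>d\<close> suffices because the distance in the product is at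
    most the sum of the two distances.\<close>
  define e where "e = min (min e1 e2) (d / 3)"
  have "y \<in> D \<and> v \<in> U \<and> f (y, v) \<le> f (x, u) + \<gamma>" if yv: "dist y x \<le> e" "dist v u \<le> e" for y v
  proof -
    have "y \<in> cball x e1" "v \<in> cball u e2"
      using yv by (simp_all add: e_def dist_commute)
    then have in_DU: "y \<in> D" "v \<in> U" using e1 e2 by blast+
    have "dist (y, v) (x, u) \<le> dist y x + dist v u"
      unfolding dist_Pair_Pair by (rule sqrt_sum_squares_le_sum) simp_all
    also have "\<dots> < d" using yv d(1) by (simp add: e_def)
    finally have "dist (f (y, v)) (f (x, u)) < \<gamma>"
      using in_DU closure_subset by (intro d(2)) auto
    then show ?thesis using in_DU by (simp add: dist_real_def abs_less_iff)
  qed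
  moreover have "e > 0" using e1 e2 d by (simp add: e_def)
  ultimately show ?thesis by blast
qed

text \<open>\<open>D\<close> is not assumed bounded, so \<open>f\<close> may be unbounded on it. But
  finitely many transients from the compact set \<open>K\<close> visit a compact set, and its part
  in \<open>closure D\<close> is compact as well.\<close>

lemma transient_bound:
  fixes f :: "(real ^ 'd) \<times> (real ^ 'm) \<Rightarrow> real"
  assumes "finite J" and J: "\<forall>(T, v)\<in>J. v \<in> controls U"
    and "compact K" and "compact U" and f: "continuous_on (closure D \<times> U) f"
  shows "\<exists>M\<ge>0. \<forall>T v i y. (T, v) \<in> J \<longrightarrow> i \<le> T \<longrightarrow> y \<in> K \<longrightarrow> sol A B i y v \<in> D \<longrightarrow>
    f (sol A B i y v, v i) \<le> M"
proof -
  let ?X = "\<Union>(T, v)\<in>J. \<Union>i\<in>{..T}. (\<lambda>y. sol A B i y v) ` K"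
  have "compact ?X"
    using \<open>finite J\<close> \<open>compact K\<close>
    by (intro compact_UN ballI)
      (auto intro!: compact_UN compact_continuous_image continuous_on_sol continuous_on_id)
  define S where "S = (closure D \<inter> ?X) \<times> U"
  have "compact S"
    unfolding S_def using \<open>compact ?X\<close> \<open>compact U\<close> by (intro compact_Times closed_Int_compact) auto
  moreover have "continuous_on S f"
    using f by (rule continuous_on_subset) (auto simp: S_def)
  ultimately have "bounded (f ` S)"
    by (intro compact_imp_bounded compact_continuous_image)
  then obtain M where M: "\<forall>r\<in>f ` S. norm r \<le> M"
    unfolding bounded_iff by blast
  have "f (sol A B i y v, v i) \<le> max M 0"
    if "(T, v) \<in> J" "i \<le> T" "y \<in> K" "sol A B i y v \<in> D" for T v i y
  proof -
    have "sol A B i y v \<in> ?X" using that by blast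
    moreover have "v i \<in> U" using J that(1) by (auto simp: controls_def)
    moreover have "sol A B i y v \<in> closure D" using that(4) closure_subset by blast
    ultimately have "(sol A B i y v, v i) \<in> S" by (simp add: S_def)
    then have "norm (f (sol A B i y v, v i)) \<le> M" using M by blast
    then show ?thesis
      using abs_ge_self[of "f (sol A B i y v, v i)"] by (simp add: le_max_iff_disj)
  qed
  then show ?thesis by (intro exI[of _ "max M 0"]) simp
qed

lemma P_tot_le_periodic:
  fixes A :: "real ^ 'd ^ 'd" and B :: "real ^ 'm ^ 'd"
    and U :: "(real ^ 'm) set" and D :: "(real ^ 'd) set"
    and f :: "(real ^ 'd) \<times> (real ^ 'm) \<Rightarrow> real"
  assumes A: "invertible A" "hyperbolic A" "controllable A B"
    and "compact U" and D: "control_set A B U D"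
    and f: "continuous_on (closure D \<times> U) f"
    and K: "compact K" "K \<subseteq> D"
    and data: "(p, x0, u0) \<in> periodic_data A B U D"
    and "\<gamma> > 0"
  shows "P_tot A B U f K D \<le> ereal (ln \<bar>det_unstable A\<bar> +
    ((1 / real p) * (\<Sum>i<p. f (sol A B i x0 u0, u0 i)) + \<gamma>))"
proof -
  let ?x = "\<lambda>i. sol A B i x0 u0"
  define g where "g i = f (?x i, u0 i)" for i
  define avg where "avg = (1 / real p) * (\<Sum>i<p. g i)"
  define b where "b = avg + \<gamma>"
  have per: "\<And>i. u0 (i + p) = u0 i" "\<And>i. ?x (i + p) = ?x i"
    and x_int: "\<And>i. ?x i \<in> interior D" and u_int: "\<And>i. i < p \<Longrightarrow> u0 i \<in> interior U"
    and "p \<ge> CARD('d)"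
    using data by (auto simp: periodic_data_def)
  then have "p > 0" using zero_less_card_finite[where 'a = 'd] by linarith
  have "x0 \<in> D" using x_int[of 0] interior_subset by auto
  have u0_int: "u0 i \<in> interior U" for i
    using u_int[of "i mod p"] \<open>p > 0\<close> periodic_eq_mod[of u0, OF per(1)] by simp
  define near where "near i e \<longleftrightarrow> (\<forall>y v. dist y (?x i) \<le> e \<and> dist v (u0 i) \<le> e \<longrightarrow>
    y \<in> D \<and> v \<in> U \<and> f (y, v) \<le> g i + \<gamma>)" for i e
  have "\<exists>e>0. \<forall>i<p. near i e"
  proof (rule uniform_radius)
    show "\<exists>e>0. near i e" for i
      unfolding near_def g_def
      by (rule continuous_near_interior_point[OF f x_int u0_int \<open>\<gamma> > 0\<close>])
    show "near i d" if "0 < d" "d \<le> e" "near i e" for i d e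
      unfolding near_def
    proof (intro allI impI)
      fix y v assume "dist y (?x i) \<le> d \<and> dist v (u0 i) \<le> d"
      then have "dist y (?x i) \<le> e \<and> dist v (u0 i) \<le> e" using that(2) by linarith
      then show "y \<in> D \<and> v \<in> U \<and> f (y, v) \<le> g i + \<gamma>"
        using that(3) unfolding near_def by blast
    qed
  qed
  then obtain \<epsilon> where "\<epsilon> > 0" and near_p: "\<And>i. i < p \<Longrightarrow> near i \<epsilon>" by blast
  \<comment> \<open>\<open>near\<close> is periodic in \<open>i\<close>, so the radius found over
    one period serves for all times.\<close>
  have near: "near i \<epsilon>" for i
  proof -
    have "near i \<epsilon> = near (i mod p) \<epsilon>"
      by (rule periodic_eq_mod[of "\<lambda>i. near i \<epsilon>"]) (simp add: near_def g_def per)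
    then show ?thesis using near_p[of "i mod p"] \<open>p > 0\<close> by simp
  qed
  obtain \<rho> c where "\<rho> > 0" "c \<ge> 0"
    and local: "\<And>n. \<exists>S. finite S \<and> real (card S) \<le> c * \<bar>det_unstable A\<bar> ^ n \<and>
      (\<forall>w\<in>S. \<forall>k. norm (w k) \<le> \<epsilon>) \<and>
      (\<forall>z\<in>cball 0 \<rho>. \<exists>w\<in>S. \<forall>k\<le>n. norm (sol A B k z w) \<le> \<epsilon>)"
    using local_spanning_controls[OF A \<open>\<epsilon> > 0\<close>] by metis
  obtain J where J: "finite J" "\<forall>(T, v)\<in>J. v \<in> controls U"
    and steer: "\<And>y. y \<in> K \<Longrightarrow> \<exists>(T, v)\<in>J. sol A B T y v \<in> ball x0 \<rho>"
    using finite_steering[OF D K \<open>x0 \<in> D\<close> \<open>\<rho> > 0\<close>] by blast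
  obtain M where "M \<ge> 0" and M: "\<forall>T v i y. (T, v) \<in> J \<longrightarrow> i \<le> T \<longrightarrow> y \<in> K \<longrightarrow>
      sol A B i y v \<in> D \<longrightarrow> f (sol A B i y v, v i) \<le> M"
    using transient_bound[OF J K(1) \<open>compact U\<close> f, where A = A and B = B]
    by blast
  obtain C0 where "C0 \<ge> 0" and C0: "\<And>m. (\<Sum>i<m. g i) \<le> real m * avg + C0"
    unfolding avg_def
    using periodic_sum_bound[of g p] per \<open>p > 0\<close> by (auto simp: g_def)
  define N where "N = Max (insert 0 (fst ` J))"
  have N: "T \<le> N" if "(T, v) \<in> J" for T v
    unfolding N_def using J(1) that image_eqI[of T fst "(T, v)" J] by (intro Max_ge) simp_all
  \<comment> \<open>At most \<open>N\<close> transient steps cost at most \<open>M\<close> each;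
    \<open>real N * \<bar>b\<bar>\<close> compensates for counting \<open>n\<close> instead of
    \<open>n - T\<close> steps at rate \<open>b\<close>; \<open>C0\<close> comes from the incomplete
    period.\<close>
  define C where "C = real N * M + real N * \<bar>b\<bar> + C0"
  \<comment> \<open>The summand \<open>1\<close> keeps the prefactor positive, as the logarithm in
    \<open>P_tot_le\<close> requires, even if \<open>c\<close> is zero.\<close>
  have bound: "a_tot A B U f K D n \<le>
      ennreal ((real (card J) * c + 1) * \<bar>det_unstable A\<bar> ^ n * exp (real n * b + C))"
    if "n \<ge> N" for n
  proof -
    obtain S where S: "finite S" "real (card S) \<le> c * \<bar>det_unstable A\<bar> ^ n"
      and small: "\<And>w k. w \<in> S \<Longrightarrow> norm (w k) \<le> \<epsilon>"
      and follow: "\<And>z. z \<in> cball 0 \<rho> \<Longrightarrow> \<exists>w\<in>S. \<forall>k\<le>n. norm (sol A B k z w) \<le> \<epsilon>"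
      using local[of n] by blast
    define ctrl where "ctrl = (\<lambda>((T, v), w). concat_control T v (\<lambda>i. u0 i + w i))"
    \<comment> \<open>\<open>u\<close> is assembled from a transient and a local control that works
      for the point to which this transient steers \<open>y\<close>.\<close>
    define G where "G y u \<longleftrightarrow> y \<in> K \<and> (\<exists>T v w. (T, v) \<in> J \<and> w \<in> S \<and> u = ctrl ((T, v), w) \<and>
      (\<forall>k\<le>n. norm (sol A B k (sol A B T y v - x0) w) \<le> \<epsilon>))" for y u
    have good: "u \<in> controls U" "\<And>k. k \<le> n \<Longrightarrow> sol A B k y u \<in> D"
      "birkhoff_sum A B f n y u \<le> real n * b + C" if "G y u" for y u
    proof -
      obtain T v w where T: "(T, v) \<in> J" "w \<in> S"
        and u: "u = concat_control T v (\<lambda>i. u0 i + w i)" and "y \<in> K"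
        and close: "\<And>k. k \<le> n \<Longrightarrow> norm (sol A B k (sol A B T y v - x0) w) \<le> \<epsilon>"
        using \<open>G y u\<close> by (auto simp: G_def ctrl_def)
      have "y \<in> D" using \<open>y \<in> K\<close> K by blast
      have dist_u: "dist (u0 k + w k) (u0 k) \<le> \<epsilon>" for k
        using small[OF T(2)] by (simp add: dist_norm)
      have v: "v \<in> controls U" using J(2) T(1) by blast
      have "T \<le> n" using N[OF T(1)] \<open>n \<ge> N\<close> by simp
      \<comment> \<open>Superposition: after the transient, the deviation from the periodic orbit
        solves the linear system with control \<open>w\<close>, started at the steering
        error.\<close>
      have late: "sol A B (T + l) y u = ?x l + sol A B l (sol A B T y v - x0) w" for l
        using sol_plus[of A B l x0 "sol A B T y v - x0" u0 w]
        by (simp add: u sol_concat_control_add)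
      have dist_late: "dist (sol A B (T + l) y u) (?x l) \<le> \<epsilon>" if "l \<le> n" for l
        using close[OF that] by (simp add: late dist_norm)
      have u_late: "u (T + l) = u0 l + w l" for l
        by (simp add: u concat_control_def)
      have late_near: "sol A B (T + l) y u \<in> D" "u0 l + w l \<in> U"
        "f (sol A B (T + l) y u, u0 l + w l) \<le> g l + \<gamma>" if "l \<le> n" for l
        using near[of l] dist_late[OF that] dist_u[of l] unfolding near_def by blast+
      have w_U: "u0 l + w l \<in> U" for l
        using near[of l] dist_u[of l] \<open>\<epsilon> > 0\<close> unfolding near_def
        by (metis dist_self less_imp_le)
      then show "u \<in> controls U"
        unfolding u using v
        by (intro concat_control_in_controls) (auto simp: controls_def)
      have early: "sol A B k y u = sol A B k y v" if "k \<le> T" for k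
        unfolding u using that by (rule sol_concat_control_le)
      \<comment> \<open>At \<open>l = 0\<close> the end of the transient is close to
        \<open>x0\<close> and so lies in \<open>D\<close>; the earlier transient states follow by
        \<open>control_set_no_return\<close>.\<close>
      have "sol A B T y v \<in> D"
        using late_near(1)[of 0] early[of T] by simp
      then have early_D: "sol A B k y v \<in> D" if "k \<le> T" for k
        using control_set_no_return[OF D \<open>y \<in> D\<close> v] that by blast
      show "sol A B k y u \<in> D" if "k \<le> n" for k
      proof (cases "k \<le> T")
        case True
        then show ?thesis using early early_D by simp
      next
        case False
        then obtain l where l: "k = T + l" using le_Suc_ex nat_le_linear by blast
        with that show ?thesis using late_near(1)[of l] by simp
      qed
      obtain m where m: "n = T + m" using \<open>T \<le> n\<close> le_Suc_ex by blast
      have "(\<Sum>i<T. f (sol A B i y u, u i)) \<le> (\<Sum>i<T. M)"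
      proof (rule sum_mono)
        fix i assume "i \<in> {..<T}"
        then have "f (sol A B i y v, v i) \<le> M"
          using M T(1) \<open>y \<in> K\<close> early_D by simp
        with \<open>i \<in> {..<T}\<close> show "f (sol A B i y u, u i) \<le> M"
          by (simp add: early) (simp add: u concat_control_def)
      qed
      also have "\<dots> \<le> real N * M"
        using N[OF T(1)] \<open>M \<ge> 0\<close> by (simp add: mult_right_mono)
      finally have first: "(\<Sum>i<T. f (sol A B i y u, u i)) \<le> real N * M" .
      have "(\<Sum>l<m. f (sol A B (T + l) y u, u (T + l))) \<le> (\<Sum>l<m. g l + \<gamma>)"
        unfolding u_late by (rule sum_mono, rule late_near(3)) (simp add: m)
      also have "\<dots> = (\<Sum>l<m. g l) + real m * \<gamma>"
        by (simp add: sum.distrib)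
      also have "\<dots> \<le> real m * b + C0"
        using C0[of m] by (simp add: b_def algebra_simps)
      finally have second: "(\<Sum>l<m. f (sol A B (T + l) y u, u (T + l))) \<le> real m * b + C0" .
      have "- (real T * b) \<le> real T * \<bar>b\<bar>"
        using mult_left_mono[OF abs_ge_minus_self[of b], of "real T"] by simp
      also have "\<dots> \<le> real N * \<bar>b\<bar>"
        using N[OF T(1)] by (simp add: mult_right_mono)
      finally have "real m * b \<le> real n * b + real N * \<bar>b\<bar>"
        by (simp add: m algebra_simps)
      with first second show "birkhoff_sum A B f n y u \<le> real n * b + C"
        unfolding birkhoff_sum_def m sum_lessThan_add by (simp add: C_def m)
    qed
    \<comment> \<open>Only combinations that serve some point of \<open>K\<close> are kept, because
      a totally spanning set needs a point \<open>\<xi> u\<close> in \<open>K\<close> for every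
      control \<open>u\<close>.\<close>
    define S' where "S' = {u. \<exists>y. G y u}"
    define \<xi> where "\<xi> u = (SOME y. G y u)" for u
    have \<xi>: "G (\<xi> u) u" if "u \<in> S'" for u
      using that unfolding S'_def \<xi>_def by (auto intro: someI_ex)
    have "S' \<subseteq> ctrl ` (J \<times> S)"
      by (auto simp: S'_def G_def)
    then have "finite S'" "card S' \<le> card J * card S"
      using J(1) S(1) card_mono[of "ctrl ` (J \<times> S)" S'] card_image_le[of "J \<times> S" ctrl]
      by (auto intro: finite_subset simp: card_cartesian_product)
    have card: "real (card S') \<le> (real (card J) * c + 1) * \<bar>det_unstable A\<bar> ^ n"
    proof -
      have "real (card S') \<le> real (card J) * real (card S)"
        using \<open>card S' \<le> card J * card S\<close> by (simp flip: of_nat_mult)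
      also have "\<dots> \<le> real (card J) * (c * \<bar>det_unstable A\<bar> ^ n)"
        using S(2) by (intro mult_left_mono) simp_all
      also have "\<dots> \<le> (real (card J) * c + 1) * \<bar>det_unstable A\<bar> ^ n"
        by (simp add: algebra_simps)
      finally show ?thesis .
    qed
    have "spanning A B U n K D S'"
      unfolding spanning_def
    proof (intro conjI ballI)
      show "S' \<subseteq> controls U" using good(1) by (auto simp: S'_def)
      fix y assume "y \<in> K"
      then obtain T v where T: "(T, v) \<in> J" "sol A B T y v \<in> ball x0 \<rho>"
        using steer by blast
      then have "sol A B T y v - x0 \<in> cball 0 \<rho>"
        by (simp add: dist_norm norm_minus_commute)
      then obtain w where w: "w \<in> S" "\<forall>k\<le>n. norm (sol A B k (sol A B T y v - x0) w) \<le> \<epsilon>"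
        using follow by blast
      then have "G y (ctrl ((T, v), w))"
        using T \<open>y \<in> K\<close> unfolding G_def by blast
      then show "\<exists>u\<in>S'. \<forall>k\<in>{1..n}. sol A B k y u \<in> D"
        using good(2) by (intro bexI[of _ "ctrl ((T, v), w)"]) (auto simp: S'_def)
    qed
    from a_tot_le[OF \<open>finite S'\<close> card this, of \<xi> f "real n * b + C"] show ?thesis
      using good(2,3) \<xi> by (auto simp: G_def)
  qed
  have "det_unstable A \<noteq> 0"
    using hyperbolic_splitting[OF A(1,2)] by (metis invertible_det_nz)
  then have "P_tot A B U f K D \<le> ereal (ln \<bar>det_unstable A\<bar> + b)"
    using \<open>c \<ge> 0\<close> by (intro P_tot_le[OF _ _ bound]) (simp_all add: add_nonneg_pos)
  then show ?thesis by (simp add: b_def avg_def g_def)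
qed

theorem proposition28:
  fixes A :: "real ^ 'd ^ 'd" and B :: "real ^ 'm ^ 'd"
    and U :: "(real ^ 'm) set" and D :: "(real ^ 'd) set"
    and f :: "(real ^ 'd) \<times> (real ^ 'm) \<Rightarrow> real"
  assumes "invertible A"
    and "convex U" and "compact U" and "0 \<in> interior U" and "U = closure (interior U)"
    and "controllable A B"
    and "hyperbolic A"
    and "control_set A B U D" and "interior D \<noteq> {}"
    and "continuous_on (closure D \<times> U) f"
  shows "\<exists>K. compact K \<and> K \<subseteq> D \<and> interior K \<noteq> {} \<and>
    P_tot A B U f K D \<le> ereal (ln \<bar>det_unstable A\<bar>) +
      (INF (\<tau>, x, u)\<in>periodic_data A B U D. ereal ((1 / real \<tau>) * (\<Sum>i<\<tau>. f (sol A B i x u, u i))))"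
proof -
  obtain y where "y \<in> interior D" using assms(9) by blast
  then obtain r where r: "r > 0" "cball y r \<subseteq> D"
    by (auto simp: mem_interior_cball)
  let ?K = "cball y r" and ?l = "ereal (ln \<bar>det_unstable A\<bar>)"
  let ?avg = "\<lambda>(\<tau>, x, u). ereal ((1 / real \<tau>) * (\<Sum>i<\<tau>. f (sol A B i x u, u i)))"
  \<comment> \<open>As \<open>?l\<close> is finite, it can be moved to the left before the infimum
    is taken; this also covers an empty set of periodic data, whose infimum is \<infinity>.\<close>
  have "P_tot A B U f ?K D - ?l \<le> ?avg q" if "q \<in> periodic_data A B U D" for q
  proof -
    obtain p x u where q: "q = (p, x, u)" by (cases q)
    have "P_tot A B U f ?K D \<le> (?avg q + ?l) + ereal \<gamma>" if "\<gamma> > 0" for \<gamma>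
      using P_tot_le_periodic[OF assms(1,7,6,3,8,10) compact_cball r(2) _ that, of p x u]
        \<open>q \<in> periodic_data A B U D\<close>
      by (simp add: q add_ac)
    then have "P_tot A B U f ?K D \<le> ?avg q + ?l"
      by (rule ereal_le_epsilon2)
    then show ?thesis by (simp add: ereal_minus_le)
  qed
  then have "P_tot A B U f ?K D - ?l \<le> (INF q\<in>periodic_data A B U D. ?avg q)"
    by (rule INF_greatest)
  then have "P_tot A B U f ?K D \<le> ?l + (INF q\<in>periodic_data A B U D. ?avg q)"
    by (simp add: ereal_minus_le add.commute)
  with r show ?thesis
    by (intro exI[of _ ?K]) (simp add: interior_cball)
qed

end
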